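(* Let $Q=(-1,1)^2\subset \mathbb{R}^2$. There exists a sequence $\{u_n\}_n\subset C^\infty_c (Q)$ of incompressible vector fields such that, denoting $\omega_n:=\operatorname{curl} u_n$, it holds $$\|u_n\|_{L^1}\rightarrow 0, \qquad \|\omega_n\|_{L^1}=1\quad \forall n \qquad \text{and}\qquad |u_n|^2\overset{*} {\rightharpoonup} \frac14 \mathcal L^2 \quad \text{in } \mathcal M(Q),$$ where $\mathcal L^2$ denotes the two-dimensional Lebesgue measure. Being compactly supported, the construction works on $\mathbb{T}^2$ as well.
   Context: "Incompressible" means divergence-free; $\operatorname{curl}v=\partial_1v_2-\partial_2v_1$. $\mathcal M(Q)$ is the space of finite Borel measures on $Q$. $\mathbb{T}^2$ is a two-dimensional flat torus; fields compactly supported in $Q$ are regarded as fields on a torus whose fundamental domain contains $Q$. *)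

theory Defs
  imports "HOL-Analysis.Analysis"
begin

definition partial_deriv :: "'n \<Rightarrow> (real^'n::finite \<Rightarrow> 'b::real_normed_vector) \<Rightarrow> real^'n \<Rightarrow> 'b" where
  "partial_deriv i f x = vector_derivative (\<lambda>t. f (x + t *\<^sub>R axis i 1)) (at 0)"

primrec C_k :: "nat \<Rightarrow> (real^'n::finite \<Rightarrow> 'b::real_normed_vector) \<Rightarrow> bool" where
  "C_k 0 f \<longleftrightarrow> continuous_on UNIV f"
| "C_k (Suc k) f \<longleftrightarrow> f differentiable_on UNIV \<and> (\<forall>i. C_k k (partial_deriv i f))"

definition C_infinity :: "(real^'n::finite \<Rightarrow> 'b::real_normed_vector) \<Rightarrow> bool" where
  "C_infinity f \<longleftrightarrow> (\<forall>k. C_k k f)"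

text \<open>Elements of \<open>C\<^sub>c\<^sup>\<infinity>(S)\<close>, for open \<open>S\<close>, are represented by their extension by zero to the whole space.\<close>

definition C_infinity_c :: "(real^'n::finite) set \<Rightarrow> (real^'n \<Rightarrow> 'b::real_normed_vector) set" where
  "C_infinity_c S =
    {f. C_infinity f \<and> compact (closure {x. f x \<noteq> 0}) \<and> closure {x. f x \<noteq> 0} \<subseteq> S}"

definition incompressible :: "(real^'n::finite \<Rightarrow> real^'n) \<Rightarrow> bool" where
  "incompressible v \<longleftrightarrow> (\<forall>x. (\<Sum>i\<in>UNIV. partial_deriv i (\<lambda>y. v y $ i) x) = 0)"

definition curl :: "(real^2 \<Rightarrow> real^2) \<Rightarrow> real^2 \<Rightarrow> real" where
  "curl v x = partial_deriv 1 (\<lambda>y. v y $ 2) x - partial_deriv 2 (\<lambda>y. v y $ 1) x"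

definition L1_norm :: "'a::euclidean_space set \<Rightarrow> ('a \<Rightarrow> 'b::real_normed_vector) \<Rightarrow> real" where
  "L1_norm S f = (LINT x:S|lborel. norm (f x))"

definition square_Q :: "(real^2) set" where
  "square_Q = {x. \<forall>i. -1 < x $ i \<and> x $ i < 1}"

text \<open>Only nonnegative measures are needed, so \<open>\<M>(S)\<close> is restricted to its positive cone.\<close>

definition finite_Borel_measures :: "'a::topological_space set \<Rightarrow> 'a measure set" where
  "finite_Borel_measures S = {\<mu>. sets \<mu> = sets (restrict_space borel S) \<and> finite_measure \<mu>}"

text \<open>For locally compact \<open>S\<close>, \<open>\<M>(S)\<close> is the dual of the space of continuous functions on \<open>S\<close> that
  vanish at the boundary and at infinity.\<close>

definition C_zero :: "'a::topological_space set \<Rightarrow> ('a \<Rightarrow> real) set" where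
  "C_zero S = {\<phi>. continuous_on S \<phi> \<and>
     (\<forall>\<epsilon>>0. \<exists>K. compact K \<and> K \<subseteq> S \<and> (\<forall>x\<in>S - K. \<bar>\<phi> x\<bar> < \<epsilon>))}"

text \<open>The parameter \<open>T\<close> is the predual: \<open>C_zero S\<close> for \<open>\<M>(S)\<close>, and the continuous periodic
  functions when \<open>S\<close> is a fundamental domain representing a torus.\<close>

definition weak_star_tendsto ::
  "'a::topological_space set \<Rightarrow> ('a \<Rightarrow> real) set \<Rightarrow> (nat \<Rightarrow> 'a measure) \<Rightarrow> 'a measure \<Rightarrow> bool" where
  "weak_star_tendsto S T \<mu> \<nu> \<longleftrightarrow>
     (\<forall>n. \<mu> n \<in> finite_Borel_measures S) \<and> \<nu> \<in> finite_Borel_measures S \<and>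
     (\<forall>\<phi>\<in>T. (\<lambda>n. \<integral>x. \<phi> x \<partial>\<mu> n) \<longlonglongrightarrow> (\<integral>x. \<phi> x \<partial>\<nu>))"

definition lebesgue_density :: "'a::euclidean_space set \<Rightarrow> ('a \<Rightarrow> real) \<Rightarrow> 'a measure" where
  "lebesgue_density S f = density (restrict_space lborel S) (\<lambda>x. ennreal (f x))"

text \<open>The flat torus \<open>\<real>\<^sup>2/\<Lambda>\<close>, \<open>\<Lambda> = \<int>a + \<int>b\<close>: functions on it are \<open>\<Lambda>\<close>-periodic functions on
  \<open>\<real>\<^sup>2\<close>, and integrals and measures on it are taken on a fundamental domain.\<close>

definition lattice_of :: "real^2 \<Rightarrow> real^2 \<Rightarrow> (real^2) set" where
  "lattice_of a b = {of_int m *\<^sub>R a + of_int n *\<^sub>R b | m n :: int. True}"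

definition is_lattice :: "(real^2) set \<Rightarrow> bool" where
  "is_lattice \<Lambda> \<longleftrightarrow> (\<exists>a b. a \<noteq> b \<and> independent {a, b} \<and> \<Lambda> = lattice_of a b)"

definition fundamental_domain :: "(real^2) set \<Rightarrow> (real^2) set \<Rightarrow> bool" where
  "fundamental_domain \<Lambda> D \<longleftrightarrow> D \<in> sets borel \<and> (\<forall>x. \<exists>!y. y \<in> D \<and> x - y \<in> \<Lambda>)"

definition lattice_periodic :: "(real^2) set \<Rightarrow> (real^2 \<Rightarrow> 'b) \<Rightarrow> bool" where
  "lattice_periodic \<Lambda> f \<longleftrightarrow> (\<forall>x. \<forall>l\<in>\<Lambda>. f (x + l) = f x)"

definition C_torus :: "(real^2) set \<Rightarrow> (real^2 \<Rightarrow> real) set" where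
  "C_torus \<Lambda> = {\<phi>. continuous_on UNIV \<phi> \<and> lattice_periodic \<Lambda> \<phi>}"

text \<open>The \<open>\<Lambda>\<close>-periodic function which agrees with \<open>f\<close> on the fundamental domain \<open>D\<close>.\<close>

definition torus_extension :: "(real^2) set \<Rightarrow> (real^2) set \<Rightarrow> (real^2 \<Rightarrow> 'b) \<Rightarrow> real^2 \<Rightarrow> 'b" where
  "torus_extension \<Lambda> D f x = f (THE y. y \<in> D \<and> x - y \<in> \<Lambda>)"

end

theory Submission imports Defs begin

text \<open>
  In \<open>\<real>\<^sup>2\<close> the \<open>L\<^sup>1\<close> norm of the vorticity just fails to control the energy: the field of a point vortex
  decays like \<open>1/r\<close>, so its energy diverges logarithmically. Superposing the dyadic rescalings
  \<open>2\<^sup>j B(2\<^sup>j x)\<close>, \<open>j < k\<close>, of one radial vortex \<open>B\<close> whose vorticity has the form \<open>f(x) - 4 f(2x)\<close>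
  makes this quantitative: the vorticities telescope and stay bounded in \<open>L\<^sup>1\<close>, so do the fields,
  while the energy is at least \<open>k\<close> times that of \<open>B\<close>. Let \<open>V\<close> be such a vortex, with energy \<open>E\<close> and
  vorticity \<open>W\<close>. Filling each cell of an \<open>N \<times> N\<close> grid on \<open>Q\<close> with a copy of \<open>V\<close>, normalised to total
  vorticity \<open>1\<close>, gives total energy \<open>E / (N W)\<^sup>2\<close>, equally distributed among the cells. This tends to
  \<open>1\<close> for \<open>N = \<lfloor>\<surd>E / W\<rfloor>\<close> as \<open>E \<rightarrow> \<infinity>\<close>, and \<open>N \<rightarrow> \<infinity>\<close>.
\<close>

section \<open>The calculus of \<open>C_k\<close>\<close>

text \<open>The scaling exponents of the plane decide everything. Passing from B(x) to 2^j B(2^j x)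
  keeps both the energy and the L1 norm of the vorticity, and divides the L1 norm of the field by
  2^j. Energies of the dyadic copies add up without loss because all copies turn the same way, so
  that cross terms are nonnegative. A vorticity f(x) - 4 f(2x) has integral 0, which is what lets a
  radial vortex vanish outside a ball instead of decaying like 1/r. The copies in the grid, by
  contrast, have disjoint supports, so norms, their squares and absolute vorticities simply add.
  Since N is an integer, the energy 1 is not hit exactly: rounding leaves a factor between 1 and (1
  + 1/N)^2. Weak convergence is then proved cell by cell, because |u|^2 and 1/4 have nearly the same
  mass on each cell and a test function is nearly constant there. The factor 1/4 is the limiting
  energy 1 divided by the area 4 of Q.\<close>

lemma partial_deriv_eq:
  assumes "(f has_derivative f') (at x)"
  shows "partial_deriv i f x = f' (axis i 1)"
proof -
  have 1: "((\<lambda>t::real. x + t *\<^sub>R axis i 1) has_derivative (\<lambda>t. t *\<^sub>R axis i 1)) (at 0)"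
    by (auto intro!: derivative_eq_intros)
  have "((\<lambda>t. f (x + t *\<^sub>R axis i 1)) has_derivative (\<lambda>t. f' (t *\<^sub>R axis i 1))) (at 0)"
    using has_derivative_compose[OF 1, of f f'] assms by simp
  moreover have "f' (t *\<^sub>R axis i 1) = t *\<^sub>R f' (axis i 1)" for t
    using assms has_derivative_linear linear_scale by blast
  ultimately show ?thesis
    unfolding partial_deriv_def
    by (intro vector_derivative_at) (simp add: has_vector_derivative_def)
qed

lemma partial_deriv_cong:
  assumes "open S" "x \<in> S" "\<And>y. y \<in> S \<Longrightarrow> f y = g y" "g differentiable (at x)"
  shows "partial_deriv i f x = partial_deriv i g x"
proof -
  obtain g' where g': "(g has_derivative g') (at x)"
    using assms(4) by (auto simp: differentiable_def)
  have "(f has_derivative g') (at x)"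
    using g' assms(1-3) has_derivative_transform_within_open by metis
  then show ?thesis
    using g' partial_deriv_eq by metis
qed

lemma partial_deriv_add:
  assumes "f differentiable (at x)" "g differentiable (at x)"
  shows "partial_deriv i (\<lambda>x. f x + g x) x = partial_deriv i f x + partial_deriv i g x"
proof -
  obtain f' g' where f': "(f has_derivative f') (at x)" and g': "(g has_derivative g') (at x)"
    using assms by (auto simp: differentiable_def)
  show ?thesis
    by (simp add: partial_deriv_eq[OF has_derivative_add[OF f' g']] partial_deriv_eq[OF f'] partial_deriv_eq[OF g'])
qed

lemma partial_deriv_scaleR:
  fixes f :: "real^'n::finite \<Rightarrow> real" and g :: "real^'n \<Rightarrow> 'b::real_normed_vector"
  assumes "f differentiable (at x)" "g differentiable (at x)"
  shows "partial_deriv i (\<lambda>x. f x *\<^sub>R g x) x = f x *\<^sub>R partial_deriv i g x + partial_deriv i f x *\<^sub>R g x"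
proof -
  obtain f' g' where f': "(f has_derivative f') (at x)" and g': "(g has_derivative g') (at x)"
    using assms by (auto simp: differentiable_def)
  show ?thesis
    by (simp add: partial_deriv_eq[OF has_derivative_scaleR[OF f' g']] partial_deriv_eq[OF f'] partial_deriv_eq[OF g'])
qed

lemma partial_deriv_bounded_linear:
  assumes "bounded_linear L" "f differentiable (at x)"
  shows "partial_deriv i (\<lambda>x. L (f x)) x = L (partial_deriv i f x)"
proof -
  obtain f' where f': "(f has_derivative f') (at x)"
    using assms by (auto simp: differentiable_def)
  show ?thesis
    by (simp add: partial_deriv_eq[OF bounded_linear.has_derivative[OF assms(1) f']] partial_deriv_eq[OF f'])
qed

lemma partial_deriv_affine:
  assumes "f differentiable (at (r *\<^sub>R x + c))"
  shows "partial_deriv i (\<lambda>x. f (r *\<^sub>R x + c)) x = r *\<^sub>R partial_deriv i f (r *\<^sub>R x + c)"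
proof -
  obtain f' where f': "(f has_derivative f') (at (r *\<^sub>R x + c))"
    using assms by (auto simp: differentiable_def)
  have 1: "((\<lambda>x. r *\<^sub>R x + c) has_derivative (\<lambda>h. r *\<^sub>R h)) (at x)"
    by (auto intro!: derivative_eq_intros)
  have "((\<lambda>x. f (r *\<^sub>R x + c)) has_derivative (\<lambda>h. f' (r *\<^sub>R h))) (at x)"
    using has_derivative_compose[OF 1, of f f'] f' by simp
  moreover have "f' (r *\<^sub>R h) = r *\<^sub>R f' h" for h
    using f' has_derivative_linear linear_scale by blast
  ultimately show ?thesis
    using f' partial_deriv_eq by metis
qed

lemma partial_deriv_compose:
  assumes "(F has_real_derivative F') (at (f x))" "f differentiable (at x)"
  shows "partial_deriv i (\<lambda>x. F (f x)) x = F' * partial_deriv i f x"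
proof -
  obtain f' where f': "(f has_derivative f') (at x)"
    using assms by (auto simp: differentiable_def)
  have "((\<lambda>x. F (f x)) has_derivative (\<lambda>h. F' * f' h)) (at x)"
    using has_derivative_compose[OF f', of F "(*) F'"] assms(1)
    by (simp add: has_field_derivative_def)
  then show ?thesis
    using f' partial_deriv_eq by metis
qed

lemma C_k_Suc_imp: "C_k (Suc k) f \<Longrightarrow> C_k k f"
  by (induction k arbitrary: f) (auto intro: differentiable_imp_continuous_on)

lemma C_k_const: "C_k k (\<lambda>x. c)"
proof (induction k arbitrary: c)
  case (Suc k)
  have "partial_deriv i (\<lambda>x. c) = (\<lambda>x::real^'a. 0)" for i
    using partial_deriv_eq[OF has_derivative_const] by auto
  then show ?case
    using Suc by simp
qed auto

lemma C_k_add: "C_k k f \<Longrightarrow> C_k k g \<Longrightarrow> C_k k (\<lambda>x. f x + g x)"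
proof (induction k arbitrary: f g)
  case (Suc k)
  have "partial_deriv i (\<lambda>x. f x + g x) = (\<lambda>x. partial_deriv i f x + partial_deriv i g x)" for i
    using Suc.prems partial_deriv_add by (fastforce simp: differentiable_on_def)
  then show ?case
    using Suc by (auto intro!: derivative_intros)
qed (auto intro: continuous_intros)

lemma C_k_scaleR:
  fixes f :: "real^'n::finite \<Rightarrow> real"
  shows "C_k k f \<Longrightarrow> C_k k g \<Longrightarrow> C_k k (\<lambda>x. f x *\<^sub>R g x)"
proof (induction k arbitrary: f g)
  case (Suc k)
  have "partial_deriv i (\<lambda>x. f x *\<^sub>R g x)
      = (\<lambda>x. f x *\<^sub>R partial_deriv i g x + partial_deriv i f x *\<^sub>R g x)" for i
    using Suc.prems partial_deriv_scaleR by (fastforce simp: differentiable_on_def)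
  moreover have "C_k k f" "C_k k g"
    using Suc.prems C_k_Suc_imp by blast+
  ultimately show ?case
    using Suc by (auto intro!: derivative_intros C_k_add simp: differentiable_on_def)
qed (auto intro: continuous_intros)

lemma C_k_bounded_linear:
  assumes "bounded_linear L"
  shows "C_k k f \<Longrightarrow> C_k k (\<lambda>x. L (f x))"
proof (induction k arbitrary: f)
  case 0
  then show ?case
    using assms by (auto intro: bounded_linear.continuous_on)
next
  case (Suc k)
  have "partial_deriv i (\<lambda>x. L (f x)) = (\<lambda>x. L (partial_deriv i f x))" for i
    using Suc.prems partial_deriv_bounded_linear[OF assms] by (fastforce simp: differentiable_on_def)
  moreover have "(\<lambda>x. L (f x)) differentiable_on UNIV"
    using Suc.prems bounded_linear.has_derivative[OF assms]
    by (fastforce simp: differentiable_on_def differentiable_def)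
  ultimately show ?case
    using Suc by auto
qed

lemma C_k_id: "C_k k (\<lambda>x::real^'n::finite. x)"
proof (cases k)
  case (Suc k)
  have "partial_deriv i (\<lambda>x::real^'n. x) = (\<lambda>x. axis i 1)" for i
    using partial_deriv_eq[OF has_derivative_ident] by auto
  then show ?thesis
    using Suc C_k_const by auto
qed auto

lemma C_k_affine: "C_k k f \<Longrightarrow> C_k k (\<lambda>x. f (r *\<^sub>R x + c))"
proof (induction k arbitrary: f)
  case 0
  then show ?case
    by (auto intro!: continuous_on_compose2[of UNIV f] continuous_intros)
next
  case (Suc k)
  have "(\<lambda>x. f (r *\<^sub>R x + c)) differentiable (at x)" for x
    using Suc.prems
    by (intro differentiable_compose[of f "\<lambda>x. r *\<^sub>R x + c"])
      (auto simp: differentiable_on_def intro!: derivative_intros)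
  moreover have "partial_deriv i (\<lambda>x. f (r *\<^sub>R x + c)) = (\<lambda>x. r *\<^sub>R partial_deriv i f (r *\<^sub>R x + c))" for i
    using Suc.prems partial_deriv_affine by (fastforce simp: differentiable_on_def)
  moreover have "C_k k (\<lambda>x. r *\<^sub>R partial_deriv i f (r *\<^sub>R x + c))" for i
    using Suc by (intro C_k_scaleR C_k_const) auto
  ultimately show ?case
    by (simp add: differentiable_on_def)
qed

text \<open>\<open>F\<close> lists the successive derivatives of one smooth function. Taking the
  whole list lets the induction close, since differentiating \<open>F n (f x)\<close> produces
  \<open>F (Suc n) (f x)\<close>.\<close>

lemma C_k_compose:
  assumes "\<And>n t. (F n has_real_derivative F (Suc n) t) (at t)"
  shows "C_k k f \<Longrightarrow> C_k k (\<lambda>x. F n (f x))"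
proof (induction k arbitrary: n)
  case 0
  have "continuous_on UNIV (F n)"
    using assms DERIV_isCont continuous_at_imp_continuous_on by blast
  then show ?case
    using 0 by (auto intro!: continuous_on_compose2[of UNIV "F n"])
next
  case (Suc k)
  have "(\<lambda>x. F n (f x)) differentiable (at x)" for x
    using Suc.prems assms
    by (intro differentiable_compose[of "F n" f])
      (auto simp: differentiable_on_def real_differentiable_def)
  moreover have "partial_deriv i (\<lambda>x. F n (f x)) = (\<lambda>x. F (Suc n) (f x) *\<^sub>R partial_deriv i f x)" for i
    using Suc.prems partial_deriv_compose[OF assms] by (fastforce simp: differentiable_on_def)
  moreover have "C_k k (\<lambda>x. F (Suc n) (f x) *\<^sub>R partial_deriv i f x)" for i
    using Suc C_k_Suc_imp[OF Suc.prems] by (intro C_k_scaleR) auto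
  ultimately show ?case
    by (simp add: differentiable_on_def)
qed

text \<open>The derivative of the reciprocal is a product of two reciprocals and a derivative of
  \<open>f\<close>. The reciprocal thus reappears at the lower order, where the induction hypothesis
  applies.\<close>

lemma C_k_inverse:
  fixes f :: "real^'n::finite \<Rightarrow> real"
  assumes "\<And>x. f x \<noteq> 0"
  shows "C_k k f \<Longrightarrow> C_k k (\<lambda>x. inverse (f x))"
proof (induction k)
  case 0
  then show ?case
    using assms by (auto intro!: continuous_intros)
next
  case (Suc k)
  have "(\<lambda>x. inverse (f x)) differentiable (at x)" for x
    using Suc.prems assms by (auto simp: differentiable_on_def intro!: derivative_intros)
  moreover have "partial_deriv i (\<lambda>x. inverse (f x))
      = (\<lambda>x. (- inverse (f x)) *\<^sub>R inverse (f x) *\<^sub>R partial_deriv i f x)" for i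
  proof
    fix x
    have "(inverse has_real_derivative - (inverse (f x) * inverse (f x))) (at (f x))"
      using DERIV_inverse'[OF DERIV_ident assms[of x]] by simp
    then show "partial_deriv i (\<lambda>x. inverse (f x)) x = (- inverse (f x)) *\<^sub>R inverse (f x) *\<^sub>R partial_deriv i f x"
      using partial_deriv_compose Suc.prems by (fastforce simp: differentiable_on_def)
  qed
  moreover have *: "C_k k (\<lambda>x. inverse (f x))"
    using Suc C_k_Suc_imp by blast
  moreover have "C_k k (\<lambda>x. - inverse (f x))"
    using C_k_scaleR[OF C_k_const[of k "-1"] *] by simp
  ultimately have "C_k k (partial_deriv i (\<lambda>x. inverse (f x)))" for i
    using Suc.prems by (simp only: C_k.simps) (intro C_k_scaleR; simp)
  then show ?case
    using \<open>\<And>x. (\<lambda>x. inverse (f x)) differentiable (at x)\<close> by (simp add: differentiable_on_def)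
qed

text \<open>Meant for periodic extensions, which have no convenient global formula but coincide near
  each point with a globally smooth function. The hypothesis passes to
  \<open>partial_deriv i f\<close> because a partial derivative at a point depends only on values
  nearby.\<close>

lemma C_k_local:
  assumes "\<And>x. \<exists>S g. open S \<and> x \<in> S \<and> C_k k g \<and> (\<forall>y\<in>S. f y = g y)"
  shows "C_k k f"
  using assms
proof (induction k arbitrary: f)
  case 0
  have "isCont f x" for x
  proof -
    obtain S g where S: "open S" "x \<in> S" "C_k 0 g" "\<forall>y\<in>S. f y = g y"
      using 0 by blast
    have "continuous_on S g"
      using S(3) continuous_on_subset by auto
    then have "continuous_on S f"
      using S(4) continuous_on_cong by metis
    then show ?thesis
      using S continuous_on_eq_continuous_at by blast
  qed
  then show ?case
    by (simp add: continuous_at_imp_continuous_on)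
next
  case (Suc k)
  have "f differentiable (at x)" for x
  proof -
    obtain S g where S: "open S" "x \<in> S" "C_k (Suc k) g" "\<forall>y\<in>S. f y = g y"
      using Suc.prems by blast
    obtain g' where "(g has_derivative g') (at x)"
      using S(3) by (auto simp: differentiable_on_def differentiable_def)
    then have "(f has_derivative g') (at x)"
      using S has_derivative_transform_within_open[of g g' x UNIV S f] by simp
    then show ?thesis
      by (auto simp: differentiable_def)
  qed
  moreover have "C_k k (partial_deriv i f)" for i
  proof (rule Suc.IH)
    fix x
    obtain S g where S: "open S" "x \<in> S" "C_k (Suc k) g" "\<forall>y\<in>S. f y = g y"
      using Suc.prems by blast
    have "partial_deriv i f y = partial_deriv i g y" if "y \<in> S" for y
      using S that partial_deriv_cong[of S y f g] by (auto simp: differentiable_on_def)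
    then show "\<exists>S g. open S \<and> x \<in> S \<and> C_k k g \<and> (\<forall>y\<in>S. partial_deriv i f y = g y)"
      using S by (intro exI[of _ S] exI[of _ "partial_deriv i g"]) auto
  qed
  ultimately show ?case
    by (auto simp: differentiable_on_def)
qed

lemma C_infinity_differentiable: "C_infinity f \<Longrightarrow> f differentiable (at x)"
  by (metis C_infinity_def C_k.simps(2) UNIV_I differentiable_on_def)

lemma C_infinity_continuous: "C_infinity f \<Longrightarrow> continuous_on UNIV f"
  by (metis C_infinity_def C_k.simps(1))

lemma C_infinity_partial_deriv: "C_infinity f \<Longrightarrow> C_infinity (partial_deriv i f)"
  by (metis C_infinity_def C_k.simps(2))

lemma C_infinity_const: "C_infinity (\<lambda>x. c)"
  by (simp add: C_infinity_def C_k_const)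

lemma C_infinity_add: "C_infinity f \<Longrightarrow> C_infinity g \<Longrightarrow> C_infinity (\<lambda>x. f x + g x)"
  by (simp add: C_infinity_def C_k_add)

lemma C_infinity_sum:
  "(\<And>i. i \<in> I \<Longrightarrow> C_infinity (f i)) \<Longrightarrow> C_infinity (\<lambda>x. \<Sum>i\<in>I. f i x)"
  by (induction I rule: infinite_finite_induct) (auto intro: C_infinity_const C_infinity_add)

lemma C_infinity_scaleR:
  fixes f :: "real^'n::finite \<Rightarrow> real"
  shows "C_infinity f \<Longrightarrow> C_infinity g \<Longrightarrow> C_infinity (\<lambda>x. f x *\<^sub>R g x)"
  by (simp add: C_infinity_def C_k_scaleR)

lemma C_infinity_mult:
  fixes f g :: "real^'n::finite \<Rightarrow> real"
  shows "C_infinity f \<Longrightarrow> C_infinity g \<Longrightarrow> C_infinity (\<lambda>x. f x * g x)"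
  using C_infinity_scaleR[of f g] by simp

lemma C_infinity_affine: "C_infinity f \<Longrightarrow> C_infinity (\<lambda>x. f (r *\<^sub>R x + c))"
  by (simp add: C_infinity_def C_k_affine)

lemma C_infinity_bounded_linear:
  "bounded_linear L \<Longrightarrow> C_infinity f \<Longrightarrow> C_infinity (\<lambda>x. L (f x))"
  by (simp add: C_infinity_def C_k_bounded_linear)

lemma C_infinity_linear: "bounded_linear L \<Longrightarrow> C_infinity L"
  by (simp add: C_infinity_def C_k_bounded_linear[OF _ C_k_id])

lemma C_infinity_diff: "C_infinity f \<Longrightarrow> C_infinity g \<Longrightarrow> C_infinity (\<lambda>x. f x - g x)"
  using C_infinity_add[of f "\<lambda>x. - g x"] C_infinity_bounded_linear[OF bounded_linear_minus[OF bounded_linear_ident], of g]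
  by simp

lemma C_infinity_nth: "C_infinity f \<Longrightarrow> C_infinity (\<lambda>x. f x $ i)"
  by (rule C_infinity_bounded_linear[OF bounded_linear_vec_nth])

lemma C_infinity_compose:
  assumes "\<And>n t. (F n has_real_derivative F (Suc n) t) (at t)" "C_infinity f"
  shows "C_infinity (\<lambda>x. F n (f x))"
  using assms(2) C_k_compose[of F, OF assms(1)] unfolding C_infinity_def by blast

lemma C_infinity_inverse:
  fixes f :: "real^'n::finite \<Rightarrow> real"
  shows "C_infinity f \<Longrightarrow> (\<And>x. f x \<noteq> 0) \<Longrightarrow> C_infinity (\<lambda>x. inverse (f x))"
  by (simp add: C_infinity_def C_k_inverse)

lemma C_infinity_local:
  assumes "\<And>x. \<exists>S g. open S \<and> x \<in> S \<and> C_infinity g \<and> (\<forall>y\<in>S. f y = g y)"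
  shows "C_infinity f"
  unfolding C_infinity_def using C_k_local assms unfolding C_infinity_def by metis

section \<open>Smooth cutoffs\<close>

text \<open>\<open>flat 1\<close> is the classical smooth function that vanishes to infinite order
  at 0. The polynomial parameter makes the family closed under differentiation.\<close>

definition flat :: "real poly \<Rightarrow> real \<Rightarrow> real" where
  "flat p t = (if t > 0 then poly p (1 / t) * exp (- (1 / t)) else 0)"

lemma tendsto_poly_div_exp_0: "((\<lambda>y::real. poly p y * exp (- y)) \<longlongrightarrow> 0) at_top"
proof -
  have "((\<lambda>y. \<Sum>i\<le>degree p. coeff p i * (y ^ i / exp y)) \<longlongrightarrow> (\<Sum>i\<le>degree p. coeff p i * 0)) at_top"
    by (intro tendsto_intros tendsto_power_div_exp_0)
  then show ?thesis
    by (simp add: poly_altdef sum_distrib_right sum_divide_distrib exp_minus field_simps)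
qed

lemma tendsto_flat_0: "(flat p \<longlongrightarrow> 0) (at 0)"
proof -
  have "((\<lambda>t. poly p (1 / t) * exp (- (1 / t))) \<longlongrightarrow> 0) (at_right 0)"
    using filterlim_compose[OF tendsto_poly_div_exp_0 filterlim_inverse_at_top_right, of p]
    by (simp add: inverse_eq_divide)
  then have "(flat p \<longlongrightarrow> 0) (at_right 0)"
    by (rule Lim_transform_eventually) (auto simp: flat_def eventually_at_right_less eventually_at_filter)
  moreover have "(flat p \<longlongrightarrow> 0) (at_left 0)"
    by (rule tendsto_eventually) (auto simp: flat_def eventually_at_filter)
  ultimately show ?thesis
    using filterlim_split_at by blast
qed

text \<open>For t > 0 put y = 1/t; then d/dt = -y^2 d/dy turns p(y) exp(-y) into y^2 (p - p')(y)
  exp(-y).\<close>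

lemma DERIV_flat: "(flat p has_real_derivative flat (monom 1 2 * (p - pderiv p)) t) (at t)"
proof (cases t "0::real" rule: linorder_cases)
  case less
  have "((\<lambda>t. 0) has_real_derivative 0) (at t)"
    by simp
  then have "(flat p has_real_derivative 0) (at t)"
    by (rule has_field_derivative_transform_within_open[of _ _ _ "{..<0}"])
      (use less in \<open>auto simp: flat_def\<close>)
  then show ?thesis
    using less by (simp add: flat_def)
next
  case equal
  \<comment> \<open>Dividing by h multiplies the polynomial by y = 1/h, so the difference quotient
    at 0 is again a flat function.\<close>
  have "((\<lambda>h. flat p h / h) \<longlongrightarrow> 0) (at 0)"
    by (rule Lim_transform_eventually[OF tendsto_flat_0[of "monom 1 1 * p"]])
      (auto simp: flat_def poly_monom eventually_at_filter)
  then show ?thesis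
    using equal by (simp add: DERIV_def flat_def)
next
  case greater
  have "((\<lambda>t. poly p (1 / t) * exp (- (1 / t))) has_real_derivative
      flat (monom 1 2 * (p - pderiv p)) t) (at t)"
    using greater
    by (auto intro!: derivative_eq_intros DERIV_chain2[OF poly_DERIV]
        simp: flat_def poly_monom power2_eq_square algebra_simps)
  then show ?thesis
    by (rule has_field_derivative_transform_within_open[of _ _ _ "{0<..}"])
      (use greater in \<open>auto simp: flat_def\<close>)
qed

lemma C_infinity_flat: "C_infinity f \<Longrightarrow> C_infinity (\<lambda>x. flat p (f x))"
proof -
  assume f: "C_infinity f"
  define F where "F n = flat (((\<lambda>p. monom 1 2 * (p - pderiv p)) ^^ n) p)" for n
  have "C_infinity (\<lambda>x. F 0 (f x))"
    by (rule C_infinity_compose[OF _ f]) (simp add: F_def DERIV_flat)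
  then show ?thesis
    by (simp add: F_def)
qed

lemma flat_1_mono: "s \<le> t \<Longrightarrow> flat 1 s \<le> flat 1 t"
  by (auto simp: flat_def frac_le)

lemma flat_1_pos: "t > 0 \<Longrightarrow> flat 1 t > 0" and flat_1_nonpos: "t \<le> 0 \<Longrightarrow> flat 1 t = 0"
  by (auto simp: flat_def)

text \<open>Nesting \<open>flat 1\<close> in itself gives a cutoff without integration. The inner
  copy vanishes for s up to 1/4, which leaves the plateau \<open>h 0\<close> = exp(-1); the factor
  exp 4 is the reciprocal of \<open>flat 1 (1/4)\<close>, so from s = 1/2 on the outer argument is
  at most 0. The derivative is returned as well, because it becomes the vorticity profile.\<close>

lemma smooth_cutoff:
  obtains h h' :: "real \<Rightarrow> real"
  where "\<And>s. (h has_real_derivative h' s) (at s)" "continuous_on UNIV h'"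
    "\<And>f :: real^'n::finite \<Rightarrow> real. C_infinity f \<Longrightarrow> C_infinity (\<lambda>x. h (f x))"
    "\<And>s t. s \<le> t \<Longrightarrow> h t \<le> h s" "h 0 > 0" "\<And>s. s \<le> 1/4 \<Longrightarrow> h s = h 0" "\<And>s. s \<ge> 1/2 \<Longrightarrow> h s = 0"
proof -
  define d where "d = (monom 1 2 * (1 - pderiv 1) :: real poly)"
  define h where "h s = flat 1 (1 - exp 4 * flat 1 (s - 1/4))" for s
  define h' where "h' s = flat d (1 - exp 4 * flat 1 (s - 1/4)) * (- exp 4 * flat d (s - 1/4))" for s
  note D = DERIV_flat[of 1, folded d_def]
  have cont: "continuous_on A (\<lambda>x. flat p (g x))" if "continuous_on A g" for p A and g :: "real \<Rightarrow> real"
    by (rule continuous_on_compose2[OF _ that, of UNIV])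
      (auto intro: DERIV_isCont[OF DERIV_flat] continuous_at_imp_continuous_on)
  show thesis
  proof
    show "(h has_real_derivative h' s) (at s)" for s
    proof -
      have 1: "((\<lambda>s. flat 1 (s - 1/4)) has_real_derivative flat d (s - 1/4) * 1) (at s)"
        by (rule DERIV_chain2[OF D]) (auto intro!: derivative_eq_intros)
      show ?thesis
        unfolding h_def h'_def
        by (rule DERIV_chain2[OF D]) (auto intro!: derivative_eq_intros 1)
    qed
    show "continuous_on UNIV h'"
      unfolding h'_def by (intro continuous_intros cont)
    show "C_infinity (\<lambda>x. h (f x))" if "C_infinity f" for f :: "real^'n::finite \<Rightarrow> real"
      unfolding h_def
      by (intro C_infinity_flat C_infinity_diff C_infinity_mult C_infinity_const that)
    show "h t \<le> h s" if "s \<le> t" for s t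
      unfolding h_def using that by (intro flat_1_mono diff_left_mono mult_left_mono) auto
    show "h 0 > 0"
      by (simp add: h_def flat_1_nonpos flat_1_pos)
    show "h s = h 0" if "s \<le> 1/4" for s
      using that by (simp add: h_def flat_1_nonpos)
    show "h s = 0" if "s \<ge> 1/2" for s
    proof -
      have "exp 4 * flat 1 (1/4) = 1"
        by (simp add: flat_def exp_minus)
      moreover have "flat 1 (1/4) \<le> flat 1 (s - 1/4)"
        using that by (intro flat_1_mono) auto
      ultimately have "1 \<le> exp 4 * flat 1 (s - 1/4)"
        by (metis exp_ge_zero mult_left_mono)
      then show ?thesis
        by (simp add: h_def flat_1_nonpos)
    qed
  qed
qed

text \<open>The denominator \<open>s\<close> is modified near \<open>0\<close> to stay positive, so that no local argument is needed later.\<close>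

lemma smooth_reciprocal:
  obtains q :: "real \<Rightarrow> real"
  where "\<And>f :: real^'n::finite \<Rightarrow> real. C_infinity f \<Longrightarrow> (\<And>x. f x \<ge> 0) \<Longrightarrow> C_infinity (\<lambda>x. q (f x))"
    "\<And>s. s \<ge> 1/32 \<Longrightarrow> q s = inverse s"
proof
  have pos: "s + flat 1 (1/32 - s) \<noteq> 0" if "s \<ge> 0" for s
    using that flat_1_pos[of "1/32 - s"] flat_1_nonpos[of "1/32 - s"]
    by (cases "s < 1/32") auto
  show "C_infinity (\<lambda>x. inverse (f x + flat 1 (1/32 - f x)))"
    if "C_infinity f" "\<And>x. f x \<ge> 0" for f :: "real^'n::finite \<Rightarrow> real"
    using that pos
    by (intro C_infinity_inverse C_infinity_add C_infinity_flat C_infinity_diff C_infinity_const) auto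
  show "inverse (s + flat 1 (1/32 - s)) = inverse s" if "s \<ge> 1/32" for s
    using that by (simp add: flat_1_nonpos)
qed

section \<open>Radial fields and superpositions\<close>

lemma lborel_integral_affine:
  fixes f :: "'a::euclidean_space \<Rightarrow> 'b::{banach, second_countable_topology}"
  assumes "r \<noteq> 0" and f: "f \<in> borel_measurable borel"
  shows "(\<integral>x. f (r *\<^sub>R x + c) \<partial>lborel) = (\<integral>x. f x \<partial>lborel) /\<^sub>R \<bar>r\<bar> ^ DIM('a)"
proof -
  have "(\<integral>x. f x \<partial>lborel) = (\<integral>x. f x \<partial>density (distr lborel borel (\<lambda>x. c + r *\<^sub>R x)) (\<lambda>_. ennreal (\<bar>r\<bar> ^ DIM('a))))"
    using lborel_affine[OF assms(1), of c] by simp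
  also have "\<dots> = \<bar>r\<bar> ^ DIM('a) *\<^sub>R (\<integral>x. f (r *\<^sub>R x + c) \<partial>lborel)"
    using f by (subst integral_density; (subst integral_distr)?; simp add: add.commute)
  finally show ?thesis
    using assms(1) by simp
qed

lemma integrable_continuous_compact_support:
  fixes f :: "'a::euclidean_space \<Rightarrow> 'b::{banach, second_countable_topology}"
  assumes "continuous_on UNIV f" "compact K" "\<And>x. x \<notin> K \<Longrightarrow> f x = 0"
  shows "integrable lborel f"
proof -
  have "integrable lborel (\<lambda>x. indicator K x *\<^sub>R f x)"
    using assms borel_integrable_compact continuous_on_subset by (metis subset_UNIV)
  moreover have "(\<lambda>x. indicator K x *\<^sub>R f x) = f"
    using assms(3) by (auto simp: indicator_def)
  ultimately show ?thesis
    by simp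
qed

text \<open>If the integral were 0, the open set where \<open>f\<close> is nonzero would be a null
  set, but it contains \<open>a\<close>.\<close>

lemma integral_continuous_pos:
  fixes f :: "'a::euclidean_space \<Rightarrow> real"
  assumes "continuous_on UNIV f" "integrable lborel f" "\<And>x. 0 \<le> f x" "f a \<noteq> 0"
  shows "0 < (\<integral>x. f x \<partial>lborel)"
proof (rule ccontr)
  assume "\<not> 0 < (\<integral>x. f x \<partial>lborel)"
  then have "(\<integral>x. f x \<partial>lborel) = 0"
    using assms(3) by (simp add: order_antisym)
  then have "AE x in lborel. f x = 0"
    using assms integral_nonneg_eq_0_iff_AE by blast
  moreover have *: "open {x. f x \<noteq> 0}"
    using assms(1) by (intro open_Collect_neq continuous_intros)
  ultimately have "{x. f x \<noteq> 0} \<in> null_sets lborel"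
    by (subst AE_iff_null_sets) auto
  then have "negligible {x. f x \<noteq> 0}"
    by (simp add: negligible_iff_null_sets null_sets_completionI)
  then show False
    using open_not_negligible[OF *] assms(4) by auto
qed

definition perp :: "real^2 \<Rightarrow> real^2" where
  "perp x = vector [- x $ 2, x $ 1]"

lemma perp_nth [simp]: "perp x $ 1 = - x $ 2" "perp x $ 2 = x $ 1"
  by (simp_all add: perp_def)

lemma bounded_linear_perp: "bounded_linear perp"
  by (intro linear_conv_bounded_linear[THEN iffD1] linearI) (simp_all add: vec_eq_iff forall_2)

lemma norm_sq_2: "(norm (x :: real^2))\<^sup>2 = (x $ 1)\<^sup>2 + (x $ 2)\<^sup>2"
  by (simp add: norm_vec_def L2_set_def sum_2)

lemma norm_perp [simp]: "norm (perp x) = norm x"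
proof -
  have "(norm (perp x))\<^sup>2 = (norm x)\<^sup>2"
    by (simp add: norm_sq_2)
  then show ?thesis
    by simp
qed

lemma C_infinity_norm_sq: "C_infinity (\<lambda>x::real^'n::finite. (norm x)\<^sup>2)"
proof -
  have "(\<lambda>x::real^'n. (norm x)\<^sup>2) = (\<lambda>x. \<Sum>i\<in>UNIV. x $ i * x $ i)"
    by (simp add: power2_norm_eq_inner inner_vec_def)
  then show ?thesis
    by (auto intro!: C_infinity_sum C_infinity_mult C_infinity_linear[OF bounded_linear_vec_nth])
qed

lemma partial_deriv_nth:
  "V differentiable (at x) \<Longrightarrow> partial_deriv i (\<lambda>y. V y $ j) x = partial_deriv i V x $ j"
  by (rule partial_deriv_bounded_linear[OF bounded_linear_vec_nth])

lemma curl_eq: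
  "V differentiable (at x) \<Longrightarrow> curl V x = partial_deriv 1 V x $ 2 - partial_deriv 2 V x $ 1"
  by (simp add: curl_def partial_deriv_nth)

lemma incompressible_iff:
  fixes V :: "real^2 \<Rightarrow> real^2"
  assumes "\<And>x. V differentiable (at x)"
  shows "incompressible V \<longleftrightarrow> (\<forall>x. partial_deriv 1 V x $ 1 + partial_deriv 2 V x $ 2 = 0)"
  by (simp add: incompressible_def partial_deriv_nth assms sum_2)

text \<open>Profiles are functions of s = |x|^2 and not of |x|, so that the origin needs no separate
  treatment.\<close>

lemma partial_deriv_radial:
  assumes "(\<rho> has_real_derivative d) (at ((norm x)\<^sup>2))"
  shows "(\<lambda>y. \<rho> ((norm y)\<^sup>2) *\<^sub>R perp y) differentiable (at x)"
    and "partial_deriv i (\<lambda>y. \<rho> ((norm y)\<^sup>2) *\<^sub>R perp y) x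
      = \<rho> ((norm x)\<^sup>2) *\<^sub>R perp (axis i 1) + (d * (2 * x $ i)) *\<^sub>R perp x"
proof -
  have 1: "((\<lambda>y. (norm y)\<^sup>2) has_derivative (\<lambda>v. 2 * (x \<bullet> v))) (at x)"
    unfolding power2_norm_eq_inner by (auto intro!: derivative_eq_intros simp: inner_commute)
  have 2: "((\<lambda>y. \<rho> ((norm y)\<^sup>2)) has_derivative (\<lambda>v. d * (2 * (x \<bullet> v)))) (at x)"
    using has_derivative_compose[OF 1, of \<rho> "(*) d"] assms by (simp add: has_field_derivative_def)
  have 3: "(perp has_derivative perp) (at x)"
    using bounded_linear_imp_has_derivative[OF bounded_linear_perp] .
  note D = has_derivative_scaleR[OF 2 3]
  show "(\<lambda>y. \<rho> ((norm y)\<^sup>2) *\<^sub>R perp y) differentiable (at x)"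
    using D differentiable_def by blast
  show "partial_deriv i (\<lambda>y. \<rho> ((norm y)\<^sup>2) *\<^sub>R perp y) x
      = \<rho> ((norm x)\<^sup>2) *\<^sub>R perp (axis i 1) + (d * (2 * x $ i)) *\<^sub>R perp x"
    by (simp add: partial_deriv_eq[OF D] inner_axis)
qed

text \<open>The right-hand side is twice the derivative of s * rho(s) at s = |x|^2. Hence the point
  vortex rho(s) = 1/s is curl-free away from 0, and rho(s) = h(s)/s has vorticity 2 h'(s).\<close>

lemma curl_radial:
  assumes "(\<rho> has_real_derivative d) (at ((norm x)\<^sup>2))"
  shows "curl (\<lambda>y. \<rho> ((norm y)\<^sup>2) *\<^sub>R perp y) x = 2 * (\<rho> ((norm x)\<^sup>2) + (norm x)\<^sup>2 * d)"
proof -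
  have "(norm x)\<^sup>2 * d = (x $ 1 * x $ 1 + x $ 2 * x $ 2) * d"
    unfolding norm_sq_2 by (simp add: power2_eq_square)
  then show ?thesis
    by (simp add: curl_eq partial_deriv_radial[OF assms] axis_def algebra_simps)
qed

text \<open>The gradient of the profile is a multiple of x, hence orthogonal to
  \<open>perp x\<close>, and \<open>perp\<close> itself has divergence 0.\<close>

lemma incompressible_radial:
  assumes "\<And>x::real^2. \<exists>d. (\<rho> has_real_derivative d) (at ((norm x)\<^sup>2))"
  shows "incompressible (\<lambda>y. \<rho> ((norm y)\<^sup>2) *\<^sub>R perp y)"
proof -
  have "partial_deriv 1 (\<lambda>y. \<rho> ((norm y)\<^sup>2) *\<^sub>R perp y) x $ 1
      + partial_deriv 2 (\<lambda>y. \<rho> ((norm y)\<^sup>2) *\<^sub>R perp y) x $ 2 = 0" for x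
  proof -
    obtain d where "(\<rho> has_real_derivative d) (at ((norm x)\<^sup>2))"
      using assms by blast
    from partial_deriv_radial(2)[OF this] show ?thesis
      by (simp add: axis_def)
  qed
  then show ?thesis
    using partial_deriv_radial(1) assms by (subst incompressible_iff) blast+
qed

lemma partial_deriv_superposition:
  assumes "C_infinity V"
  shows "partial_deriv i (\<lambda>x. \<Sum>j\<in>I. a j *\<^sub>R V (r j *\<^sub>R x + c j)) x
    = (\<Sum>j\<in>I. (a j * r j) *\<^sub>R partial_deriv i V (r j *\<^sub>R x + c j))"
proof (induction I rule: infinite_finite_induct)
  case (insert k I)
  have C: "C_infinity (\<lambda>x. a j *\<^sub>R V (r j *\<^sub>R x + c j))" for j
    by (intro C_infinity_scaleR C_infinity_const C_infinity_affine assms)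
  have "partial_deriv i (\<lambda>x. \<Sum>j\<in>insert k I. a j *\<^sub>R V (r j *\<^sub>R x + c j)) x
      = partial_deriv i (\<lambda>x. a k *\<^sub>R V (r k *\<^sub>R x + c k)) x
        + partial_deriv i (\<lambda>x. \<Sum>j\<in>I. a j *\<^sub>R V (r j *\<^sub>R x + c j)) x"
    using insert.hyps by (simp add: partial_deriv_add C_infinity_differentiable C C_infinity_sum)
  also have "partial_deriv i (\<lambda>x. a k *\<^sub>R V (r k *\<^sub>R x + c k)) x
      = (a k * r k) *\<^sub>R partial_deriv i V (r k *\<^sub>R x + c k)"
    using partial_deriv_bounded_linear[OF bounded_linear_scaleR_right
        C_infinity_differentiable[OF C_infinity_affine[OF assms]]]
    by (simp add: partial_deriv_affine C_infinity_differentiable assms)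
  finally show ?case
    using insert by simp
qed (use partial_deriv_eq[OF has_derivative_const[of "0::'b"]] in simp_all)

text \<open>One statement for three uses: the dyadic stack (amplitude and dilation both 2^j), the
  grid (common dilation N, varying shifts), and a single translate on the torus.\<close>

lemma superposition:
  fixes V :: "real^2 \<Rightarrow> real^2" and a r :: "'i \<Rightarrow> real" and c :: "'i \<Rightarrow> real^2"
    and I :: "'i set"
  assumes "C_infinity V"
  defines "u \<equiv> \<lambda>x. \<Sum>j\<in>I. a j *\<^sub>R V (r j *\<^sub>R x + c j)"
  shows C_infinity_superposition: "C_infinity u"
    and incompressible_superposition: "incompressible V \<Longrightarrow> incompressible u"
    and curl_superposition: "curl u x = (\<Sum>j\<in>I. a j * r j * curl V (r j *\<^sub>R x + c j))"
proof -
  show 1: "C_infinity u"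
    unfolding u_def
    by (intro C_infinity_sum C_infinity_scaleR C_infinity_const C_infinity_affine assms)
  note D = C_infinity_differentiable[OF 1] C_infinity_differentiable[OF assms(1)]
  note P = partial_deriv_superposition[OF assms(1), of _ a r c I, folded u_def]
  show "incompressible u" if "incompressible V"
  proof -
    have *: "partial_deriv 1 V x $ 1 + partial_deriv 2 V x $ 2 = 0" for x
      using that by (simp add: incompressible_iff D)
    have "partial_deriv 1 u x $ 1 + partial_deriv 2 u x $ 2 = (\<Sum>j\<in>I. a j * r j *
      (partial_deriv 1 V (r j *\<^sub>R x + c j) $ 1 + partial_deriv 2 V (r j *\<^sub>R x + c j) $ 2))" for x
      by (simp add: P sum.distrib distrib_left)
    then show ?thesis
      by (simp add: incompressible_iff D *)
  qed
  show "curl u x = (\<Sum>j\<in>I. a j * r j * curl V (r j *\<^sub>R x + c j))"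
    by (simp add: curl_eq D P sum_subtractf right_diff_distrib)
qed

lemma C_infinity_cI:
  assumes "C_infinity f" "compact K" "K \<subseteq> S" "\<And>x. x \<notin> K \<Longrightarrow> f x = 0"
  shows "f \<in> C_infinity_c S"
proof -
  have "closure {x. f x \<noteq> 0} \<subseteq> K"
    using assms by (intro closure_minimal compact_imp_closed) auto
  moreover from this have "compact (closure {x. f x \<noteq> 0})"
    using compact_Int_closed[OF assms(2) closed_closure, of "{x. f x \<noteq> 0}"] by (simp add: inf.absorb2)
  ultimately show ?thesis
    using assms(1,3) by (auto simp: C_infinity_c_def)
qed

lemma C_infinity_cD:
  assumes "f \<in> C_infinity_c S"
  shows "C_infinity f" "\<exists>K. compact K \<and> K \<subseteq> S \<and> (\<forall>x. x \<notin> K \<longrightarrow> f x = 0)"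
proof -
  show "C_infinity f"
    using assms by (simp add: C_infinity_c_def)
  have "f x = 0" if "x \<notin> closure {x. f x \<noteq> 0}" for x
    using that closure_subset[of "{x. f x \<noteq> 0}"] by blast
  then show "\<exists>K. compact K \<and> K \<subseteq> S \<and> (\<forall>x. x \<notin> K \<longrightarrow> f x = 0)"
    using assms unfolding C_infinity_c_def by blast
qed

lemma partial_deriv_eq_0:
  assumes "compact K" "\<And>x. x \<notin> K \<Longrightarrow> f x = 0" "x \<notin> K"
  shows "partial_deriv i f x = 0"
proof -
  have "partial_deriv i f x = partial_deriv i (\<lambda>x. 0) x"
    using assms by (intro partial_deriv_cong[of "- K"]) (auto simp: compact_imp_closed)
  then show ?thesis
    by (simp add: partial_deriv_eq[OF has_derivative_const])
qed

lemma curl_eq_0: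
  assumes "compact K" "\<And>x. x \<notin> K \<Longrightarrow> V x = 0" "x \<notin> K"
  shows "curl V x = 0"
  using assms by (simp add: curl_def partial_deriv_eq_0[of K])

lemma continuous_curl: "C_infinity V \<Longrightarrow> continuous_on UNIV (curl V)"
  unfolding curl_def[abs_def]
  by (intro continuous_intros C_infinity_continuous C_infinity_partial_deriv C_infinity_nth)

section \<open>Concentrated vortices\<close>

lemma cball_subset_square_Q: "cball 0 (3/4) \<subseteq> square_Q"
proof
  fix x :: "real^2" assume "x \<in> cball 0 (3/4)"
  then have "\<bar>x $ i\<bar> < 1" for i
    using component_le_norm_cart[of x i] by simp
  then show "x \<in> square_Q"
    by (simp add: square_Q_def abs_less_iff minus_less_iff)
qed

text \<open>The cross terms are nonnegative. Applied to the pointwise norms of copies that rotate in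
  the same direction, it makes the energy grow at least linearly in their number.\<close>

lemma sum_squares_le_square_sum:
  fixes a :: "nat \<Rightarrow> real"
  assumes "\<And>j. 0 \<le> a j"
  shows "(\<Sum>j<k. (a j)\<^sup>2) \<le> (\<Sum>j<k. a j)\<^sup>2"
proof (induction k)
  case (Suc k)
  have "0 \<le> 2 * (\<Sum>j<k. a j) * a k"
    using assms by (simp add: sum_nonneg)
  with Suc show ?case
    by (simp add: power2_sum mult_ac)
qed simp

text \<open>\<open>C\<close> is chosen before \<open>E\<close>: L1 bounds on field and vorticity do
  not control the energy. Away from the origin put A(x) = h(|x|^2)/|x|^2 perp(x), a point vortex cut
  off at distance about 1. Then B(x) = A(x) - 2 A(2x), and the sum \<open>V k\<close> below is A(x)
  - 2^k A(2^k x), the same point vortex with its core removed at scale 2^-k.\<close>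

lemma concentrated_vortex:
  "\<exists>C>0. \<forall>E. \<exists>V. V \<in> C_infinity_c square_Q \<and> incompressible V \<and> (\<integral>x. norm (V x) \<partial>lborel) \<le> C
     \<and> 0 < (\<integral>x. \<bar>curl V x\<bar> \<partial>lborel) \<and> (\<integral>x. \<bar>curl V x\<bar> \<partial>lborel) \<le> C
     \<and> E \<le> (\<integral>x. (norm (V x))\<^sup>2 \<partial>lborel)"
proof -

  \<comment> \<open>The radial profile\<close>
  obtain h h' :: "real \<Rightarrow> real" where
    h: "\<And>s. (h has_real_derivative h' s) (at s)" and h'_cont: "continuous_on UNIV h'"
    and h_smooth: "\<And>f :: real^2 \<Rightarrow> real. C_infinity f \<Longrightarrow> C_infinity (\<lambda>x. h (f x))"
    and h_mono: "\<And>s t. s \<le> t \<Longrightarrow> h t \<le> h s" and h_pos: "h 0 > 0"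
    and h_const: "\<And>s. s \<le> 1/4 \<Longrightarrow> h s = h 0" and h_0: "\<And>s. s \<ge> 1/2 \<Longrightarrow> h s = 0"
    using smooth_cutoff by blast
  obtain q :: "real \<Rightarrow> real" where
    q_smooth: "\<And>f :: real^2 \<Rightarrow> real. C_infinity f \<Longrightarrow> (\<And>x. f x \<ge> 0) \<Longrightarrow> C_infinity (\<lambda>x. q (f x))"
    and q: "\<And>s. s \<ge> 1/32 \<Longrightarrow> q s = inverse s"
    using smooth_reciprocal by blast
  \<comment> \<open>The numerator vanishes for s up to 1/16, where both values of \<open>h\<close>
    equal \<open>h 0\<close>, while \<open>q\<close> is the true reciprocal from 1/32 on. So
    \<open>b s\<close> is (h(s) - h(4s))/s for all s > 0, without a singularity at 0, and it is
    nonnegative because \<open>h\<close> decreases.\<close>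
  define b where "b s = (h s - h (4 * s)) * q s" for s
  have b_nonneg: "b s \<ge> 0" if "s \<ge> 0" for s
    using that h_mono[of s "4 * s"] h_const[of s] h_const[of "4 * s"] q[of s]
    by (cases "s \<le> 1/16") (auto simp: b_def)
  have b_0: "b s = 0" if "s \<ge> 1/2" for s
    using that h_0 by (simp add: b_def)
  have h'_0: "h' s = 0" if "s < 1/4 \<or> s > 1/2" for s
  proof -
    have "(h has_real_derivative 0) (at s)"
    proof (cases "s < 1/4")
      case True
      have "((\<lambda>s. h 0) has_real_derivative 0) (at s)"
        by simp
      then show ?thesis
        by (rule has_field_derivative_transform_within_open[of _ _ _ "{..<1/4}"])
          (use True in \<open>auto intro: h_const[symmetric]\<close>)
    next
      case False
      have "((\<lambda>s. 0) has_real_derivative 0) (at s)"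
        by simp
      then show ?thesis
        by (rule has_field_derivative_transform_within_open[of _ _ _ "{1/2<..}"])
          (use False that in \<open>auto simp: h_0\<close>)
    qed
    then show ?thesis
      using h DERIV_unique by blast
  qed
  have dh: "((\<lambda>s. h s - h (4 * s)) has_real_derivative h' s - 4 * h' (4 * s)) (at s)" for s
    using DERIV_chain2[OF h, of "\<lambda>s. 4 * s" 4 s]
    by (auto intro!: derivative_eq_intros h)
  \<comment> \<open>\<open>b s + s * d\<close> is the derivative of s * b(s) = h(s) - h(4s). Below
    1/16 the profile is locally 0; from 1/16 on, the half-line s > 1/32 is a neighbourhood on which
    the quotient formula is exact.\<close>
  have db: "\<exists>d. (b has_real_derivative d) (at s) \<and> b s + s * d = h' s - 4 * h' (4 * s)"
    if "s \<ge> 0" for s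
  proof (cases "s < 1/16")
    case True
    have b: "b t = 0" if "t < 1/16" for t
      using that h_const[of t] h_const[of "4 * t"] by (simp add: b_def)
    have "((\<lambda>s. 0) has_real_derivative 0) (at s)"
      by simp
    then have "(b has_real_derivative 0) (at s)"
      by (rule has_field_derivative_transform_within_open[of _ _ _ "{..<1/16}"])
        (use True in \<open>auto simp: b\<close>)
    then show ?thesis
      using True h'_0[of s] h'_0[of "4 * s"] by (intro exI[of _ 0]) (simp add: b)
  next
    case False
    have b: "b t = (h t - h (4 * t)) / t" if "t > 1/32" for t
      using that q[of t] by (simp add: b_def inverse_eq_divide)
    define d where "d = ((h' s - 4 * h' (4 * s)) * s - (h s - h (4 * s)) * 1) / (s * s)"
    have "((\<lambda>s. (h s - h (4 * s)) / s) has_real_derivative d) (at s)"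
      unfolding d_def using False by (intro DERIV_divide dh DERIV_ident) auto
    then have "(b has_real_derivative d) (at s)"
      by (rule has_field_derivative_transform_within_open[of _ _ _ "{1/32<..}"])
        (use False in \<open>auto simp: b\<close>)
    then show ?thesis
      using False by (intro exI[of _ d]) (auto simp: b d_def field_simps)
  qed

  \<comment> \<open>The basic vortex and its vorticity\<close>
  define B where "B x = b ((norm x)\<^sup>2) *\<^sub>R perp x" for x :: "real^2"
  define f where "f x = 2 * h' ((norm x)\<^sup>2)" for x :: "real^2"
  have B_smooth: "C_infinity B"
    unfolding B_def b_def
    by (intro C_infinity_scaleR C_infinity_mult C_infinity_diff h_smooth q_smooth C_infinity_norm_sq C_infinity_const
        C_infinity_linear[OF bounded_linear_perp]) auto
  have B_incompressible: "incompressible B"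
    unfolding B_def using db by (intro incompressible_radial) (meson zero_le_power2)
  have curl_B: "curl B x = f x - 4 * f (2 *\<^sub>R x)" for x
  proof -
    obtain d where d: "(b has_real_derivative d) (at ((norm x)\<^sup>2))"
      "b ((norm x)\<^sup>2) + (norm x)\<^sup>2 * d = h' ((norm x)\<^sup>2) - 4 * h' (4 * (norm x)\<^sup>2)"
      using db by (meson zero_le_power2)
    from curl_radial[OF d(1)] show ?thesis
      unfolding B_def f_def d(2) by (simp add: power_mult_distrib)
  qed
  \<comment> \<open>\<open>b\<close> and \<open>h'\<close> vanish for s > 1/2, and (3/4)^2 = 9/16
    exceeds 1/2.\<close>
  let ?K = "cball (0 :: real^2) (3/4)"
  have far: "(norm x)\<^sup>2 > 1/2" if "x \<notin> ?K" for x :: "real^2"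
    using that power_strict_mono[of "3/4" "norm x" 2] by (simp add: power2_eq_square)
  have B_0: "B x = 0" and f_0: "f x = 0" if "x \<notin> ?K" for x
    using far[OF that] b_0 h'_0 by (auto simp: B_def f_def)
  have f_cont: "continuous_on UNIV f"
    unfolding f_def
    by (intro continuous_intros continuous_on_compose2[OF h'_cont]) auto
  have B_cont: "continuous_on UNIV B"
    by (rule C_infinity_continuous[OF B_smooth])
  have [measurable]: "f \<in> borel_measurable borel" "B \<in> borel_measurable borel"
    using f_cont B_cont by (auto intro: borel_measurable_continuous_onI)
  have scale: "integrable lborel (\<lambda>x. g (r *\<^sub>R x))"
    if "continuous_on UNIV g" "\<And>x. x \<notin> ?K \<Longrightarrow> g x = 0" "r \<ge> 1" for g :: "real^2 \<Rightarrow> real" and r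
  proof (rule integrable_continuous_compact_support[of _ ?K])
    show "continuous_on UNIV (\<lambda>x. g (r *\<^sub>R x))"
      by (intro continuous_on_compose2[OF that(1)] continuous_intros) auto
    show "g (r *\<^sub>R x) = 0" if "x \<notin> ?K" for x
    proof -
      have "norm x \<le> norm (r *\<^sub>R x)"
        using \<open>r \<ge> 1\<close> mult_right_mono[of 1 r "norm x"] by simp
      then show ?thesis
        using that \<open>\<And>x. x \<notin> ?K \<Longrightarrow> g x = 0\<close>[of "r *\<^sub>R x"] by auto
    qed
  qed auto
  have int: "(\<integral>x. g (r *\<^sub>R x) \<partial>lborel) = (\<integral>x. g x \<partial>lborel) / r\<^sup>2"
    if "r > 0" "g \<in> borel_measurable borel" for r and g :: "real^2 \<Rightarrow> real"
    using lborel_integral_affine[of r g 0] that by (simp add: divide_inverse mult.commute)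

  \<comment> \<open>The dyadic superposition\<close>
  define V where "V k x = (\<Sum>j<k. 2 ^ j *\<^sub>R B (2 ^ j *\<^sub>R x + 0))" for k :: nat and x
  have V_smooth: "C_infinity (V k)" and V_incompressible: "incompressible (V k)" for k
    using C_infinity_superposition[OF B_smooth, where I = "{..<k}" and a = "(^) 2" and r = "(^) 2" and c = "\<lambda>_. 0"]
      incompressible_superposition[OF B_smooth B_incompressible, where I = "{..<k}" and a = "(^) 2" and r = "(^) 2" and c = "\<lambda>_. 0"]
    unfolding V_def[abs_def] by auto
  have curl_V: "curl (V k) x = f x - 4 ^ k * f (2 ^ k *\<^sub>R x)" for k x
  proof -
    have "curl (V k) x = (\<Sum>j<k. 2 ^ j * 2 ^ j * curl B (2 ^ j *\<^sub>R x + 0))"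
      using curl_superposition[OF B_smooth, where I = "{..<k}" and a = "(^) 2" and r = "(^) 2" and c = "\<lambda>_. 0"]
      unfolding V_def[abs_def] by auto
    also have "\<dots> = (\<Sum>j<k. 4 ^ j * f (2 ^ j *\<^sub>R x) - 4 ^ Suc j * f (2 ^ Suc j *\<^sub>R x))"
      by (intro sum.cong refl) (simp add: curl_B right_diff_distrib flip: power_mult_distrib)
    also have "\<dots> = f x - 4 ^ k * f (2 ^ k *\<^sub>R x)"
      by (induction k) auto
    finally show ?thesis .
  qed
  \<comment> \<open>At each point all copies are nonnegative multiples of the same vector
    \<open>perp x\<close>, so the triangle inequality is an equality.\<close>
  have norm_V: "norm (V k x) = (\<Sum>j<k. norm (2 ^ j *\<^sub>R B (2 ^ j *\<^sub>R x)))" for k x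
  proof -
    have "V k x = (\<Sum>j<k. 2 ^ j * b ((norm (2 ^ j *\<^sub>R x))\<^sup>2) * 2 ^ j) *\<^sub>R perp x"
      unfolding V_def B_def
      by (simp add: scaleR_sum_left linear_scale[OF bounded_linear.linear[OF bounded_linear_perp]] mult.assoc)
    also have "norm \<dots> = (\<Sum>j<k. 2 ^ j * b ((norm (2 ^ j *\<^sub>R x))\<^sup>2) * 2 ^ j) * norm x"
      using b_nonneg by (simp add: sum_nonneg)
    finally show ?thesis
      using b_nonneg by (simp add: B_def sum_distrib_left mult_ac)
  qed
  have V_0: "V k x = 0" if "x \<notin> ?K" for k x
  proof -
    have "B (2 ^ j *\<^sub>R x) = 0" for j :: nat
    proof (rule B_0)
      have "norm x \<le> norm (2 ^ j *\<^sub>R x)"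
        using mult_right_mono[of 1 "2 ^ j" "norm x"] by simp
      then show "2 ^ j *\<^sub>R x \<notin> ?K"
        using that by simp
    qed
    then show ?thesis
      by (simp add: V_def)
  qed
  have V_cont: "continuous_on UNIV (V k)" for k
    by (rule C_infinity_continuous[OF V_smooth])
  have f_int: "integrable lborel (\<lambda>x. \<bar>f (r *\<^sub>R x)\<bar>)" if "r \<ge> 1" for r
    using that f_cont f_0 by (intro scale[of "\<lambda>x. \<bar>f x\<bar>"] continuous_intros) auto
  have curl_int: "integrable lborel (\<lambda>x. \<bar>curl (V k) x\<bar>)" for k
    using curl_eq_0[of ?K "V k"] V_0
    by (intro integrable_continuous_compact_support[of _ ?K] continuous_intros continuous_curl V_smooth) auto

  \<comment> \<open>Bounds uniform in k, and growth of the energy\<close>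
  define L W e where "L = (\<integral>x. norm (B x) \<partial>lborel)" and "W = (\<integral>x. \<bar>f x\<bar> \<partial>lborel)"
    and "e = (\<integral>x. (norm (B x))\<^sup>2 \<partial>lborel)"
  \<comment> \<open>The copy with index j has amplitude factor 2^j and area factor 4^-j, so its L1
    norm is L / 2^j and the geometric series stays below 2 L.\<close>
  have L: "(\<integral>x. norm (V k x) \<partial>lborel) \<le> 2 * L" for k
  proof -
    have L0: "L \<ge> 0"
      by (simp add: L_def)
    have "(\<integral>x. norm (V k x) \<partial>lborel) = (\<Sum>j<k. \<integral>x. norm (2 ^ j *\<^sub>R B (2 ^ j *\<^sub>R x)) \<partial>lborel)"
      unfolding norm_V using B_cont B_0
      by (intro Bochner_Integration.integral_sum)
        (auto intro!: integrable_mult_right scale[of "\<lambda>x. norm (B x)"] continuous_intros)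
    also have "\<dots> = (\<Sum>j<k. (1/2) ^ j * L)"
      using int[of "2 ^ _" "\<lambda>x. norm (B x)"]
      by (intro sum.cong refl) (simp add: L_def power2_eq_square power_one_over)
    also have "\<dots> = (\<Sum>j<k. (1/2) ^ j) * L"
      by (simp add: sum_distrib_right)
    also have "\<dots> \<le> 2 * L"
      using L0 by (intro mult_right_mono) (simp_all add: sum_gp_strict)
    finally show ?thesis .
  qed
  \<comment> \<open>Only the two ends of the telescoping sum remain. Each has L1 norm
    \<open>W\<close>, since the factor 4^k cancels the change of area.\<close>
  have W: "(\<integral>x. \<bar>curl (V k) x\<bar> \<partial>lborel) \<le> 2 * W" for k
  proof -
    have "(\<integral>x. \<bar>curl (V k) x\<bar> \<partial>lborel) \<le> (\<integral>x. \<bar>f x\<bar> + 4 ^ k * \<bar>f (2 ^ k *\<^sub>R x)\<bar> \<partial>lborel)"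
    proof (rule integral_mono)
      show "integrable lborel (\<lambda>x. \<bar>f x\<bar> + 4 ^ k * \<bar>f (2 ^ k *\<^sub>R x)\<bar>)"
        using f_int[of 1] f_int[of "2 ^ k"] by simp
      show "\<bar>curl (V k) x\<bar> \<le> \<bar>f x\<bar> + 4 ^ k * \<bar>f (2 ^ k *\<^sub>R x)\<bar>" for x
        using abs_triangle_ineq4[of "f x" "4 ^ k * f (2 ^ k *\<^sub>R x)"] by (simp add: curl_V abs_mult)
    qed (rule curl_int)
    also have "\<dots> = W + 4 ^ k * (\<integral>x. \<bar>f (2 ^ k *\<^sub>R x)\<bar> \<partial>lborel)"
      using f_int[of 1] f_int[of "2 ^ k"] by (simp add: W_def)
    also have "(\<integral>x. \<bar>f (2 ^ k *\<^sub>R x)\<bar> \<partial>lborel) = W / (2 ^ k)\<^sup>2"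
      unfolding W_def by (intro int) auto
    also have "(2 ^ k)\<^sup>2 = (4 :: real) ^ k"
      by (simp add: power2_eq_square flip: power_mult_distrib)
    finally show ?thesis
      by simp
  qed
  have W_pos: "0 < (\<integral>x. \<bar>curl (V k) x\<bar> \<partial>lborel)" if "k \<ge> 1" for k
  proof -
    \<comment> \<open>\<open>h\<close> drops from \<open>h 0\<close> to 0 on [1/4, 1/2], so
      \<open>h'\<close> is nonzero at some s in between. For k >= 1 the inner end of the telescoped
      vorticity vanishes at this radius, because 4^k s exceeds 1/2; nothing cancels
      \<open>f x\<close>.\<close>
    obtain s where s: "1/4 < s" "s < 1/2" "h (1/2) - h (1/4) = (1/2 - 1/4) * h' s"
      using MVT2[of "1/4" "1/2" h h'] h by auto
    define x :: "real^2" where "x = sqrt s *\<^sub>R axis 1 1"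
    have x: "(norm x)\<^sup>2 = s"
      using s by (simp add: x_def)
    have "4 ^ k \<ge> (4 :: real)"
      using that power_increasing[of 1 k "4::real"] by simp
    then have "4 ^ k * s > 1/2"
      using s mult_strict_mono[of 4 "4 ^ k" "1/4" s] mult_mono[of 4 "4 ^ k" s s] by linarith
    moreover have "(norm (2 ^ k *\<^sub>R x))\<^sup>2 = 4 ^ k * s"
      using x by (simp add: power_mult_distrib) (simp add: power2_eq_square flip: power_mult_distrib)
    ultimately have "f (2 ^ k *\<^sub>R x) = 0"
      by (simp only: f_def) (simp add: h'_0)
    moreover have "f x \<noteq> 0"
      using s(3) h_0[of "1/2"] h_const[of "1/4"] h_pos by (auto simp: f_def x)
    ultimately have "\<bar>curl (V k) x\<bar> \<noteq> 0"
      by (simp add: curl_V)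
    then show ?thesis
      using curl_int V_smooth by (intro integral_continuous_pos continuous_intros continuous_curl) auto
  qed
  have e_pos: "e > 0"
    unfolding e_def
  proof (rule integral_continuous_pos)
    \<comment> \<open>At s = 1/4 the outer cutoff still equals \<open>h 0\<close> and the inner one,
      taken at 4s = 1, is already 0, so the profile is positive there.\<close>
    define x :: "real^2" where "x = (1/2) *\<^sub>R axis 1 1"
    have x: "(norm x)\<^sup>2 = 1/4"
      by (simp add: x_def power2_eq_square)
    have b: "b (1/4) \<noteq> 0"
      using h_pos h_const[of "1/4"] h_0[of 1] by (simp add: b_def q)
    have B: "norm (B x) = \<bar>b (1/4)\<bar> * norm x"
      by (simp only: B_def x norm_scaleR norm_perp)
    show "(norm (B x))\<^sup>2 \<noteq> 0"
      unfolding B using b by (simp add: x_def)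
    show "integrable lborel (\<lambda>x. (norm (B x))\<^sup>2)"
      using B_cont B_0 by (intro integrable_continuous_compact_support[of _ ?K] continuous_intros) auto
  qed (use B_cont in \<open>auto intro!: continuous_intros\<close>)
  \<comment> \<open>Every copy has energy exactly \<open>e\<close>: the squared amplitude 4^j
    cancels the area factor 4^-j.\<close>
  have e: "real k * e \<le> (\<integral>x. (norm (V k x))\<^sup>2 \<partial>lborel)" for k
  proof -
    have sc: "integrable lborel (\<lambda>x. (norm (2 ^ j *\<^sub>R B (2 ^ j *\<^sub>R x)))\<^sup>2)" for j :: nat
      using B_cont B_0 by (intro scale[of "\<lambda>x. (norm (2 ^ j *\<^sub>R B x))\<^sup>2" "2 ^ j"] continuous_intros) auto
    have "(\<integral>x. (norm (2 ^ j *\<^sub>R B (2 ^ j *\<^sub>R x)))\<^sup>2 \<partial>lborel) = e" for j :: nat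
      using int[of "2 ^ j" "\<lambda>x. (norm (2 ^ j *\<^sub>R B x))\<^sup>2"] by (simp add: e_def power_mult_distrib)
    then have "real k * e = (\<Sum>j<k. \<integral>x. (norm (2 ^ j *\<^sub>R B (2 ^ j *\<^sub>R x)))\<^sup>2 \<partial>lborel)"
      by simp
    also have "\<dots> = (\<integral>x. (\<Sum>j<k. (norm (2 ^ j *\<^sub>R B (2 ^ j *\<^sub>R x)))\<^sup>2) \<partial>lborel)"
      using sc by (intro Bochner_Integration.integral_sum[symmetric]) auto
    also have "\<dots> \<le> (\<integral>x. (norm (V k x))\<^sup>2 \<partial>lborel)"
    proof (rule integral_mono)
      show "integrable lborel (\<lambda>x. \<Sum>j<k. (norm (2 ^ j *\<^sub>R B (2 ^ j *\<^sub>R x)))\<^sup>2)"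
        using sc by (intro Bochner_Integration.integrable_sum) auto
      show "integrable lborel (\<lambda>x. (norm (V k x))\<^sup>2)"
        using V_cont V_0 by (intro integrable_continuous_compact_support[of _ ?K] continuous_intros) auto
      show "(\<Sum>j<k. (norm (2 ^ j *\<^sub>R B (2 ^ j *\<^sub>R x)))\<^sup>2) \<le> (norm (V k x))\<^sup>2" for x
        unfolding norm_V by (intro sum_squares_le_square_sum) auto
    qed
    finally show ?thesis .
  qed
  show ?thesis
  \<comment> \<open>The sum dominates both L1 bounds at once, and the summand 1 makes it strictly
    positive.\<close>
  proof (intro exI[of _ "2 * L + 2 * W + 1"] conjI allI)
    have LW: "L \<ge> 0" "W \<ge> 0"
      by (auto simp: L_def W_def)
    then show "0 < 2 * L + 2 * W + 1"
      by simp
    fix E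
    \<comment> \<open>The maximum with 1 excludes k = 0, for which the superposition is the zero
      field and has no vorticity.\<close>
    obtain k :: nat where k: "max 1 (E / e) \<le> real k"
      using real_arch_simple by blast
    then have "E \<le> real k * e"
      using e_pos by (simp add: field_simps)
    moreover have "k \<ge> 1"
      using k by simp
    moreover have "V k \<in> C_infinity_c square_Q"
      using V_smooth V_0 cball_subset_square_Q by (intro C_infinity_cI[of _ ?K]) auto
    ultimately show "\<exists>V. V \<in> C_infinity_c square_Q \<and> incompressible V
        \<and> (\<integral>x. norm (V x) \<partial>lborel) \<le> 2 * L + 2 * W + 1
        \<and> 0 < (\<integral>x. \<bar>curl V x\<bar> \<partial>lborel) \<and> (\<integral>x. \<bar>curl V x\<bar> \<partial>lborel) \<le> 2 * L + 2 * W + 1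
        \<and> E \<le> (\<integral>x. (norm (V x))\<^sup>2 \<partial>lborel)"
      using V_incompressible[of k] L[of k] W[of k] W_pos[of k] e[of k] LW
      by (intro exI[of _ "V k"]) linarith+
  qed
qed

section \<open>Arrays of vortices\<close>

lemma square_Q_eq_box: "square_Q = box (\<chi> i. -1) (\<chi> i. 1)"
  by (auto simp: square_Q_def mem_box_cart)

lemma open_square_Q: "open square_Q"
  by (simp add: square_Q_eq_box open_box)

lemma measure_square_Q: "measure lborel square_Q = 4" "emeasure lborel square_Q < \<infinity>"
proof -
  have b: "(\<chi> i. 1) \<bullet> b = 1" "(\<chi> i. -1) \<bullet> b = -1" if "b \<in> Basis" for b :: "real^2"
    using that by (auto simp: Basis_vec_def inner_axis)
  show "measure lborel square_Q = 4" "emeasure lborel square_Q < \<infinity>"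
    unfolding square_Q_eq_box by (simp_all add: measure_lborel_box_eq emeasure_lborel_box_eq b inner_diff_left)
qed

text \<open>At most one summand is nonzero, so any map fixing 0 commutes with the sum. It is applied
  pointwise to the norm, its square and the absolute value.\<close>

lemma map_sum_disjoint_support:
  assumes "finite I" "F 0 = 0" "\<And>p q. p \<in> I \<Longrightarrow> q \<in> I \<Longrightarrow> p \<noteq> q \<Longrightarrow> g p = 0 \<or> g q = 0"
  shows "F (\<Sum>p\<in>I. g p) = (\<Sum>p\<in>I. F (g p))"
proof (cases "\<exists>p\<in>I. g p \<noteq> 0")
  case True
  then obtain p where p: "p \<in> I" "g p \<noteq> 0"
    by blast
  then have "g q = 0" if "q \<in> I - {p}" for q
    using assms(3)[of p q] that by auto
  then show ?thesis
    using assms(1,2) p by (simp add: sum.remove[of I p])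
next
  case False
  then show ?thesis
    using assms(2) by simp
qed

text \<open>Replacing \<open>\<psi>\<close> by the constant \<open>t\<close> costs at most
  \<open>\<epsilon>\<close> times each mass; what remains is \<open>t\<close> times the difference
  of the two masses. This compares the energy with the density 1/4 on a single grid cell.\<close>

lemma integral_diff_bound_oscillation:
  fixes \<psi> g1 g2 :: "'a \<Rightarrow> real"
  assumes "integrable M g1" "integrable M g2" "integrable M (\<lambda>x. \<psi> x * g1 x)" "integrable M (\<lambda>x. \<psi> x * g2 x)"
    and nonneg: "\<And>x. 0 \<le> g1 x" "\<And>x. 0 \<le> g2 x"
    and supp: "\<And>x. x \<notin> S \<Longrightarrow> g1 x = 0" "\<And>x. x \<notin> S \<Longrightarrow> g2 x = 0"
    and osc: "\<And>x. x \<in> S \<Longrightarrow> \<bar>\<psi> x - t\<bar> \<le> \<epsilon>" and "\<bar>t\<bar> \<le> B"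
  shows "\<bar>(\<integral>x. \<psi> x * g1 x \<partial>M) - (\<integral>x. \<psi> x * g2 x \<partial>M)\<bar>
    \<le> B * \<bar>(\<integral>x. g1 x \<partial>M) - (\<integral>x. g2 x \<partial>M)\<bar> + \<epsilon> * ((\<integral>x. g1 x \<partial>M) + (\<integral>x. g2 x \<partial>M))"
proof -
  have *: "\<bar>(\<integral>x. \<psi> x * g x \<partial>M) - t * (\<integral>x. g x \<partial>M)\<bar> \<le> \<epsilon> * (\<integral>x. g x \<partial>M)"
    if "integrable M g" "integrable M (\<lambda>x. \<psi> x * g x)" "\<And>x. 0 \<le> g x" "\<And>x. x \<notin> S \<Longrightarrow> g x = 0" for g
  proof -
    have "(\<integral>x. \<psi> x * g x \<partial>M) - t * (\<integral>x. g x \<partial>M) = (\<integral>x. (\<psi> x - t) * g x \<partial>M)"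
      using that by (simp add: left_diff_distrib)
    also have "\<bar>\<dots>\<bar> \<le> (\<integral>x. \<bar>(\<psi> x - t) * g x\<bar> \<partial>M)"
      by (rule integral_abs_bound)
    also have "\<dots> \<le> (\<integral>x. \<epsilon> * g x \<partial>M)"
    proof (rule integral_mono)
      show "integrable M (\<lambda>x. \<bar>(\<psi> x - t) * g x\<bar>)"
        using that by (intro integrable_abs) (simp add: left_diff_distrib)
      show "\<bar>(\<psi> x - t) * g x\<bar> \<le> \<epsilon> * g x" for x
        using that osc[of x] by (cases "x \<in> S") (auto simp: abs_mult intro: mult_right_mono)
    qed (use that in simp)
    finally show ?thesis
      by simp
  qed
  have "\<bar>t * ((\<integral>x. g1 x \<partial>M) - (\<integral>x. g2 x \<partial>M))\<bar> \<le> B * \<bar>(\<integral>x. g1 x \<partial>M) - (\<integral>x. g2 x \<partial>M)\<bar>"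
    unfolding abs_mult using assms(10) by (intro mult_right_mono) auto
  with *[OF assms(1,3) nonneg(1) supp(1)] *[OF assms(2,4) nonneg(2) supp(2)] show ?thesis
    unfolding right_diff_distrib distrib_left by linarith
qed

text \<open>Each of the N^2 cells has area factor 1/N^2, so the counts cancel. Differentiation
  brings a factor N, hence amplitude 1/w with this \<open>w\<close> gives total vorticity 1. The
  energy carries no such factor and becomes \<open>\<theta>\<close>, to be compared with the mass 1
  of the density 1/4 on Q. The last conclusion is an explicit error bound, so \<open>N\<close> and
  \<open>\<theta>\<close> can be chosen afterwards.\<close>

lemma vortex_array:
  fixes N :: nat
  assumes V: "V \<in> C_infinity_c square_Q" "incompressible V" and N: "N \<ge> 1"
    and W: "0 < (\<integral>x. \<bar>curl V x\<bar> \<partial>lborel)"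
  defines "w \<equiv> real N * (\<integral>x. \<bar>curl V x\<bar> \<partial>lborel)"
  defines "\<theta> \<equiv> (\<integral>x. (norm (V x))\<^sup>2 \<partial>lborel) / w\<^sup>2"
  obtains u where "u \<in> C_infinity_c square_Q" "incompressible u"
    "(\<integral>x. norm (u x) \<partial>lborel) = (\<integral>x. norm (V x) \<partial>lborel) / w" "(\<integral>x. \<bar>curl u x\<bar> \<partial>lborel) = 1"
    "\<And>\<psi> B \<epsilon>. continuous_on UNIV \<psi> \<Longrightarrow> (\<And>x. x \<in> square_Q \<Longrightarrow> \<bar>\<psi> x\<bar> \<le> B) \<Longrightarrow>
      (\<And>x y. x \<in> square_Q \<Longrightarrow> y \<in> square_Q \<Longrightarrow> dist x y \<le> 2 / real N \<Longrightarrow> \<bar>\<psi> x - \<psi> y\<bar> \<le> \<epsilon>) \<Longrightarrow>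
      \<bar>(\<integral>x. \<psi> x * (norm (u x))\<^sup>2 \<partial>lborel) - (\<integral>x. \<psi> x * (1/4 * indicator square_Q x) \<partial>lborel)\<bar>
        \<le> B * \<bar>\<theta> - 1\<bar> + \<epsilon> * (\<theta> + 1)"
proof -
  obtain K where K: "C_infinity V" "compact K" "K \<subseteq> square_Q" "\<And>x. x \<notin> K \<Longrightarrow> V x = 0"
    using C_infinity_cD[OF V(1)] by blast
  have V_0: "V x = 0" and curl_0: "curl V x = 0" if "x \<notin> square_Q" for x
    using that K curl_eq_0[of K V x] by auto
  define I where "I = {..<N} \<times> {..<N}"
  \<comment> \<open>\<open>T p\<close> blows up the cell with index p = (i, j) onto Q. Cells are
    counted from the lower left corner starting at 0, and cell i of the first coordinate is the
    interval from -1 + 2i/N to -1 + 2(i+1)/N.\<close>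
  define T where "T p x = real N *\<^sub>R x + vector [real N - 2 * real (fst p) - 1, real N - 2 * real (snd p) - 1]"
    for p and x :: "real^2"
  have I: "finite I" "card I = N\<^sup>2"
    by (auto simp: I_def power2_eq_square)
  have T_Q: "T p x \<in> square_Q \<longleftrightarrow>
      2 * real (fst p) < real N * (x $ 1 + 1) \<and> real N * (x $ 1 + 1) < 2 * real (fst p) + 2 \<and>
      2 * real (snd p) < real N * (x $ 2 + 1) \<and> real N * (x $ 2 + 1) < 2 * real (snd p) + 2" for p x
    by (auto simp: square_Q_def T_def forall_2 algebra_simps)
  have T_disj: "p = q" if "T p x \<in> square_Q" "T q x \<in> square_Q" for p q x
  proof -
    have "real (fst p) < real (fst q) + 1" "real (fst q) < real (fst p) + 1"
      "real (snd p) < real (snd q) + 1" "real (snd q) < real (snd p) + 1"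
      using that unfolding T_Q by linarith+
    then show ?thesis
      by (intro prod_eqI) linarith+
  qed
  have T_in: "x \<in> square_Q" if "p \<in> I" "T p x \<in> square_Q" for p x
  proof -
    have i: "real (fst p) + 1 \<le> real N" "real (snd p) + 1 \<le> real N"
      using that(1) by (auto simp: I_def)
    have "0 < real N * (x $ 1 + 1)" "real N * (x $ 1 + 1) < real N * 2"
      "0 < real N * (x $ 2 + 1)" "real N * (x $ 2 + 1) < real N * 2"
      using that(2) i unfolding T_Q by linarith+
    then show ?thesis
      using N by (auto simp: square_Q_def forall_2 zero_less_mult_iff)
  qed
  \<comment> \<open>\<open>c p\<close> is the centre of the cell, the zero of
    \<open>T p\<close>.\<close>
  define c where "c p = (1 / real N) *\<^sub>R - T p 0" for p
  have T_c: "T p x = real N *\<^sub>R (x - c p)" for p x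
    using N by (simp add: T_def c_def algebra_simps)
  have T_inj: "x = (1 / real N) *\<^sub>R T p x + c p" for p x
    using N by (simp add: T_c)
  have T_cont: "continuous_on UNIV (T p)" for p
    unfolding T_def by (intro continuous_intros)
  then have [measurable]: "T p \<in> borel_measurable borel" for p
    by (rule borel_measurable_continuous_onI)
  have [measurable]: "square_Q \<in> sets borel"
    using open_square_Q by simp
  have int_T: "(\<integral>x. g (T p x) \<partial>lborel) = (\<integral>x. g x \<partial>lborel) / (real N)\<^sup>2"
    if "g \<in> borel_measurable borel" for g :: "real^2 \<Rightarrow> real" and p
    unfolding T_def using lborel_integral_affine[OF _ that, of "real N"] N
    by (simp add: divide_inverse mult.commute)
  have T_K: "compact {x. T p x \<in> K}" for p
  proof -
    have "{x. T p x \<in> K} = (\<lambda>y. (1 / real N) *\<^sub>R y + c p) ` K"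
      using N T_inj by (auto simp: T_c image_iff intro!: bexI[of _ "T p _"])
    then show ?thesis
      using K(2) by (auto intro!: compact_continuous_image continuous_intros)
  qed
  have intg: "integrable lborel (\<lambda>x. \<psi> x * g (T p x))"
    if "continuous_on UNIV \<psi>" "continuous_on UNIV g" "\<And>x. x \<notin> K \<Longrightarrow> g x = 0" for \<psi> g :: "real^2 \<Rightarrow> real" and p
    using that T_K[of p]
    by (intro integrable_continuous_compact_support[of _ "{x. T p x \<in> K}"] continuous_intros
        continuous_on_compose2[OF that(2) T_cont]) auto
  define a where "a = 1 / w"
  have w: "w > 0"
    using N W by (simp add: w_def)
  then have a: "a > 0"
    by (simp add: a_def)
  define u where "u x = (\<Sum>p\<in>I. a *\<^sub>R V (T p x))" for x
  have V_cont: "continuous_on UNIV V" and curl_cont: "continuous_on UNIV (curl V)"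
    by (auto intro: C_infinity_continuous continuous_curl K(1))
  then have [measurable]: "V \<in> borel_measurable borel" "curl V \<in> borel_measurable borel"
    by (auto intro: borel_measurable_continuous_onI)
  have V_disj: "V (T p x) = 0 \<or> V (T q x) = 0"
    and curl_disj: "curl V (T p x) = 0 \<or> curl V (T q x) = 0" if "p \<noteq> q" for p q x
    using that T_disj V_0 curl_0 by blast+
  have u_map: "F (u x) = (\<Sum>p\<in>I. F (a *\<^sub>R V (T p x)))" if "F 0 = 0" for F :: "real^2 \<Rightarrow> real" and x
    unfolding u_def using I that by (intro map_sum_disjoint_support) (simp_all, metis V_disj)
  have curl_u: "\<bar>curl u x\<bar> = (\<Sum>p\<in>I. a * real N * \<bar>curl V (T p x)\<bar>)" for x
  proof -
    have "curl u x = (\<Sum>p\<in>I. a * real N * curl V (T p x))"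
      unfolding u_def[abs_def] T_def by (rule curl_superposition[OF K(1)])
    also have "\<bar>\<dots>\<bar> = (\<Sum>p\<in>I. \<bar>a * real N * curl V (T p x)\<bar>)"
      using I curl_disj by (intro map_sum_disjoint_support) (simp_all, metis)
    finally show ?thesis
      using a by (simp add: abs_mult)
  qed
  have u_0: "u x = 0" if "x \<notin> (\<Union>p\<in>I. {x. T p x \<in> K})" for x
    using that K(4) by (simp add: u_def)
  show thesis
  proof (rule that)
    show "u \<in> C_infinity_c square_Q"
    proof (rule C_infinity_cI)
      show "C_infinity u"
        unfolding u_def[abs_def] T_def by (rule C_infinity_superposition[OF K(1)])
      show "compact (\<Union>p\<in>I. {x. T p x \<in> K})"
        using I T_K by (intro compact_UN) auto
      show "(\<Union>p\<in>I. {x. T p x \<in> K}) \<subseteq> square_Q"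
        using K(3) T_in by blast
    qed (rule u_0)
    show "incompressible u"
      unfolding u_def[abs_def] T_def by (rule incompressible_superposition[OF K(1) V(2)])
    have norm_u: "norm (u x) = (\<Sum>p\<in>I. a * norm (V (T p x)))" for x
      using u_map[of norm x] a by simp
    have "(\<integral>x. norm (u x) \<partial>lborel) = (\<Sum>p\<in>I. \<integral>x. a * norm (V (T p x)) \<partial>lborel)"
      unfolding norm_u using V_cont K(4)
      by (intro Bochner_Integration.integral_sum intg[of "\<lambda>x. a" "\<lambda>x. norm (V x)"] continuous_intros) auto
    also have "\<dots> = a * (\<integral>x. norm (V x) \<partial>lborel)"
      using int_T[of "\<lambda>x. norm (V x)"] I N by simp
    finally show "(\<integral>x. norm (u x) \<partial>lborel) = (\<integral>x. norm (V x) \<partial>lborel) / w"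
      by (simp add: a_def)
    have "(\<integral>x. \<bar>curl u x\<bar> \<partial>lborel) = (\<Sum>p\<in>I. \<integral>x. a * real N * \<bar>curl V (T p x)\<bar> \<partial>lborel)"
      unfolding curl_u using curl_cont curl_eq_0[OF K(2,4)]
      by (intro Bochner_Integration.integral_sum intg[of "\<lambda>x. a * real N" "\<lambda>x. \<bar>curl V x\<bar>"]
          continuous_intros) auto
    also have "\<dots> = a * w"
      using int_T[of "\<lambda>x. \<bar>curl V x\<bar>"] I N by (simp add: w_def)
    finally show "(\<integral>x. \<bar>curl u x\<bar> \<partial>lborel) = 1"
      using w by (simp add: a_def)
    fix \<psi> :: "real^2 \<Rightarrow> real" and B \<epsilon> :: real
    assume \<psi>: "continuous_on UNIV \<psi>" and B: "\<And>x. x \<in> square_Q \<Longrightarrow> \<bar>\<psi> x\<bar> \<le> B"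
      and \<epsilon>: "\<And>x y. x \<in> square_Q \<Longrightarrow> y \<in> square_Q \<Longrightarrow> dist x y \<le> 2 / real N \<Longrightarrow> \<bar>\<psi> x - \<psi> y\<bar> \<le> \<epsilon>"
    \<comment> \<open>\<open>g p\<close> is the part of |u|^2 in cell p and \<open>k p\<close> the
      part of the density 1/4; their masses are \<open>\<theta>\<close> / N^2 and 1 / N^2. Summing
      the cellwise comparison over N^2 cells gives the claimed bound.\<close>
    define g where "g p x = a\<^sup>2 * (norm (V (T p x)))\<^sup>2" for p x
    define k where "k p x = (1/4 :: real) * indicator square_Q (T p x)" for p x
    have [measurable]: "\<psi> \<in> borel_measurable borel"
      using \<psi> by (rule borel_measurable_continuous_onI)
    have int_g: "integrable lborel (\<lambda>x. \<phi> x * g p x)" if "continuous_on UNIV \<phi>" for \<phi> p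
      unfolding g_def using that V_cont K(4)
      by (intro intg[of \<phi> "\<lambda>x. a\<^sup>2 * (norm (V x))\<^sup>2" p] continuous_intros) auto
    have int_g_val: "(\<integral>x. g p x \<partial>lborel) = \<theta> / (real N)\<^sup>2" for p
      unfolding g_def using int_T[of "\<lambda>x. a\<^sup>2 * (norm (V x))\<^sup>2" p]
      by (simp add: \<theta>_def a_def power_divide)
    have int_Q: "integrable lborel (\<lambda>x. \<psi> x * indicator square_Q x)"
    proof (rule Bochner_Integration.integrable_bound)
      let ?C = "cbox (\<chi> i. -1) (\<chi> i. 1) :: (real^2) set"
      show "integrable lborel (\<lambda>x. indicator ?C x *\<^sub>R \<psi> x)"
        using \<psi> by (intro borel_integrable_compact) (auto intro: continuous_on_subset)
      have "square_Q \<subseteq> ?C"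
        unfolding square_Q_eq_box by (rule box_subset_cbox)
      then show "AE x in lborel. norm (\<psi> x * indicator square_Q x) \<le> norm (indicator ?C x *\<^sub>R \<psi> x)"
        by (auto simp: indicator_def)
    qed simp
    have int_1: "integrable lborel (indicator square_Q :: _ \<Rightarrow> real)"
      using measure_square_Q by (auto simp: integrable_indicator_iff)
    have k_le: "k p x \<le> 1/4 * indicator square_Q x" if "p \<in> I" for p x
      using T_in[OF that, of x] by (auto simp: k_def indicator_def)
    have [measurable]: "k p \<in> borel_measurable borel" for p
      unfolding k_def[abs_def] by measurable
    have k_abs: "\<bar>k p x\<bar> \<le> indicator square_Q x" if "p \<in> I" for p x
      using T_in[OF that, of x] by (auto simp: k_def indicator_def)
    have int_\<psi>k: "integrable lborel (\<lambda>x. \<psi> x * k p x)" if "p \<in> I" for p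
      using int_Q
      by (rule Bochner_Integration.integrable_bound) (simp_all add: abs_mult mult_left_mono k_abs[OF that])
    have int_k: "integrable lborel (k p)" if "p \<in> I" for p
      using int_1
      by (rule Bochner_Integration.integrable_bound) (use k_abs[OF that] in auto)
    have int_k_val: "(\<integral>x. k p x \<partial>lborel) = 1 / (real N)\<^sup>2" for p
      unfolding k_def using int_T[of "\<lambda>x. 1/4 * indicator square_Q x" p] measure_square_Q by simp
    have sum_k_le: "(\<Sum>p\<in>I. k p x) \<le> 1/4 * indicator square_Q x" for x
    proof (cases "\<exists>p\<in>I. T p x \<in> square_Q")
      case True
      then obtain p where p: "p \<in> I" "T p x \<in> square_Q"
        by blast
      then have "k q x = 0" if "q \<in> I - {p}" for q
        using T_disj[of p x q] that by (auto simp: k_def indicator_def)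
      then have "(\<Sum>p\<in>I. k p x) = k p x"
        using I p by (simp add: sum.remove[of I p])
      then show ?thesis
        using k_le[OF p(1)] by simp
    qed (simp add: k_def)
    \<comment> \<open>The disjoint open cells lie in \<open>Q\<close> and have total measure 4, so they exhaust \<open>Q\<close> up to a null set.\<close>
    have "(\<integral>x. 1/4 * indicator square_Q x - (\<Sum>p\<in>I. k p x) \<partial>lborel) = 0"
      using int_1 int_k I N
      by (subst Bochner_Integration.integral_diff)
        (auto simp: int_k_val measure_square_Q Bochner_Integration.integral_sum)
    then have "AE x in lborel. 1/4 * indicator square_Q x - (\<Sum>p\<in>I. k p x) = 0"
      using int_1 int_k sum_k_le
      by (subst (asm) integral_nonneg_eq_0_iff_AE) auto
    then have "AE x in lborel. \<psi> x * (1/4 * indicator square_Q x) = (\<Sum>p\<in>I. \<psi> x * k p x)"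
      by eventually_elim (simp flip: sum_distrib_left)
    then have "(\<integral>x. \<psi> x * (1/4 * indicator square_Q x) \<partial>lborel) = (\<integral>x. (\<Sum>p\<in>I. \<psi> x * k p x) \<partial>lborel)"
      by (intro integral_cong_AE) (simp_all add: k_def)
    also have "\<dots> = (\<Sum>p\<in>I. \<integral>x. \<psi> x * k p x \<partial>lborel)"
      using int_\<psi>k by (intro Bochner_Integration.integral_sum) auto
    finally have 1: "(\<integral>x. \<psi> x * (1/4 * indicator square_Q x) \<partial>lborel) = (\<Sum>p\<in>I. \<integral>x. \<psi> x * k p x \<partial>lborel)" .
    have "(norm (u x))\<^sup>2 = (\<Sum>p\<in>I. g p x)" for x
      using u_map[of "\<lambda>v. (norm v)\<^sup>2" x] by (simp add: g_def power_mult_distrib)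
    then have 2: "(\<integral>x. \<psi> x * (norm (u x))\<^sup>2 \<partial>lborel) = (\<Sum>p\<in>I. \<integral>x. \<psi> x * g p x \<partial>lborel)"
      using int_g[OF \<psi>] by (simp add: sum_distrib_left Bochner_Integration.integral_sum)
    have "\<bar>(\<integral>x. \<psi> x * g p x \<partial>lborel) - (\<integral>x. \<psi> x * k p x \<partial>lborel)\<bar>
        \<le> B * \<bar>\<theta> / (real N)\<^sup>2 - 1 / (real N)\<^sup>2\<bar> + \<epsilon> * (\<theta> / (real N)\<^sup>2 + 1 / (real N)\<^sup>2)" if p: "p \<in> I" for p
      unfolding int_g_val[symmetric, of p] int_k_val[symmetric, of p]
    proof (rule integral_diff_bound_oscillation[where S = "{x. T p x \<in> square_Q}"])
      show "integrable lborel (g p)"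
        using int_g[of "\<lambda>x. 1" p] by simp
      \<comment> \<open>The test function is frozen at its value at the centre of the cell.\<close>
      have c: "c p \<in> square_Q"
        using T_in[OF p, of "c p"] by (simp add: T_c square_Q_def)
      then show "\<bar>\<psi> (c p)\<bar> \<le> B"
        by (rule B)
      show "\<bar>\<psi> x - \<psi> (c p)\<bar> \<le> \<epsilon>" if "x \<in> {x. T p x \<in> square_Q}" for x
      proof (rule \<epsilon>)
        show "x \<in> square_Q" "c p \<in> square_Q"
          using that T_in[OF p] c by auto
        \<comment> \<open>Bounding the norm by the sum of coordinates gives 2 in place of sqrt 2,
          which is the source of the distance 2/N in the hypothesis on oscillation.\<close>
        have "norm (T p x) \<le> \<bar>T p x $ 1\<bar> + \<bar>T p x $ 2\<bar>"
          using norm_le_l1_cart[of "T p x"] by (simp add: sum_2)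
        moreover have "\<bar>T p x $ 1\<bar> < 1" "\<bar>T p x $ 2\<bar> < 1"
          using that by (auto simp: square_Q_def abs_less_iff minus_less_iff)
        ultimately have "real N * dist x (c p) \<le> 2"
          by (simp add: T_c dist_norm)
        then show "dist x (c p) \<le> 2 / real N"
          using N by (simp add: field_simps)
      qed
      show "integrable lborel (k p)" "integrable lborel (\<lambda>x. \<psi> x * g p x)" "integrable lborel (\<lambda>x. \<psi> x * k p x)"
        using int_k int_g[OF \<psi>] int_\<psi>k p by auto
    qed (auto simp: g_def k_def V_0)
    then have "\<bar>(\<Sum>p\<in>I. (\<integral>x. \<psi> x * g p x \<partial>lborel) - (\<integral>x. \<psi> x * k p x \<partial>lborel))\<bar>
        \<le> (\<Sum>p\<in>I. B * \<bar>\<theta> / (real N)\<^sup>2 - 1 / (real N)\<^sup>2\<bar> + \<epsilon> * (\<theta> / (real N)\<^sup>2 + 1 / (real N)\<^sup>2))"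
      by (intro sum_abs[THEN order_trans] sum_mono)
    also have "\<dots> = (real N)\<^sup>2 * (B * \<bar>(\<theta> - 1) / (real N)\<^sup>2\<bar> + \<epsilon> * ((\<theta> + 1) / (real N)\<^sup>2))"
      using I by (simp add: diff_divide_distrib add_divide_distrib)
    also have "\<dots> = B * \<bar>\<theta> - 1\<bar> + \<epsilon> * (\<theta> + 1)"
      using N by (simp add: abs_divide field_simps)
    finally show "\<bar>(\<integral>x. \<psi> x * (norm (u x))\<^sup>2 \<partial>lborel) - (\<integral>x. \<psi> x * (1/4 * indicator square_Q x) \<partial>lborel)\<bar>
        \<le> B * \<bar>\<theta> - 1\<bar> + \<epsilon> * (\<theta> + 1)"
      unfolding 1 2 by (simp add: sum_subtractf)
  qed
qed

section \<open>Weak convergence and the torus\<close>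

lemma lebesgue_density_integral:
  assumes "S \<in> sets borel" "f \<in> borel_measurable borel" "\<And>x. 0 \<le> f x" "continuous_on S \<phi>"
  shows "(\<integral>x. \<phi> x \<partial>lebesgue_density S f) = (\<integral>x. indicator S x * (f x * \<phi> x) \<partial>lborel)"
proof -
  have S: "S \<inter> space lborel \<in> sets lborel"
    using assms(1) by simp
  have "\<phi> \<in> borel_measurable (restrict_space lborel S)"
    using borel_measurable_continuous_on_restrict[OF assms(4)]
    by (simp cong: measurable_cong_sets sets_restrict_space_cong[of lborel borel S])
  moreover have "f \<in> borel_measurable (restrict_space lborel S)"
    using assms(2) by (intro measurable_restrict_space1) simp
  ultimately have "(\<integral>x. \<phi> x \<partial>lebesgue_density S f) = (\<integral>x. f x *\<^sub>R \<phi> x \<partial>restrict_space lborel S)"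
    unfolding lebesgue_density_def using assms(3) by (intro integral_density) auto
  then show ?thesis
    by (simp add: integral_restrict_space[OF S])
qed

lemma lebesgue_density_finite_Borel:
  assumes "S \<in> sets borel" "f \<in> borel_measurable borel" "\<And>x. 0 \<le> f x"
    and "integrable lborel (\<lambda>x. indicator S x * f x)"
  shows "lebesgue_density S f \<in> finite_Borel_measures S"
proof -
  have S: "S \<inter> space lborel \<in> sets lborel"
    using assms(1) by simp
  have f: "f \<in> borel_measurable (restrict_space lborel S)"
    using assms(2) by (intro measurable_restrict_space1) simp
  have "emeasure (lebesgue_density S f) (space (lebesgue_density S f))
      = (\<integral>\<^sup>+x. ennreal (f x) * indicator (space (restrict_space lborel S)) x \<partial>restrict_space lborel S)"
    unfolding lebesgue_density_def using f by (subst emeasure_density) auto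
  also have "\<dots> = (\<integral>\<^sup>+x. ennreal (f x) \<partial>restrict_space lborel S)"
    by (intro nn_integral_cong) simp
  also have "\<dots> = (\<integral>\<^sup>+x. ennreal (f x) * indicator S x \<partial>lborel)"
    by (rule nn_integral_restrict_space[OF S])
  also have "\<dots> = (\<integral>\<^sup>+x. ennreal (norm (indicator S x * f x)) \<partial>lborel)"
    using assms(3) by (intro nn_integral_cong) (auto simp: indicator_def)
  also have "\<dots> < \<infinity>"
    using assms(4) by (simp add: integrable_iff_bounded)
  finally have "finite_measure (lebesgue_density S f)"
    by (intro finite_measureI) auto
  moreover have "sets (lebesgue_density S f) = sets (restrict_space borel S)"
    by (simp add: lebesgue_density_def sets_restrict_space)
  ultimately show ?thesis
    by (simp add: finite_Borel_measures_def)
qed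

lemma L1_norm_eq_integral:
  assumes "\<And>x. x \<in> S \<Longrightarrow> f x = g x" "\<And>x. x \<notin> S \<Longrightarrow> g x = 0"
  shows "L1_norm S f = (\<integral>x. norm (g x) \<partial>lborel)"
  unfolding L1_norm_def set_lebesgue_integral_def
  by (rule Bochner_Integration.integral_cong) (auto simp: indicator_def assms)

text \<open>At a point outside \<open>S\<close> the complement of \<open>K\<close> is a
  neighbourhood on which the extension is below \<open>\<epsilon>\<close>. Test functions on the
  open square thus become globally continuous, like those on the torus.\<close>

lemma C_zero_extension:
  fixes \<phi> :: "'a::t2_space \<Rightarrow> real"
  assumes "open S" "\<phi> \<in> C_zero S"
  shows "continuous_on UNIV (\<lambda>x. if x \<in> S then \<phi> x else 0)"
proof -
  let ?\<psi> = "\<lambda>x. if x \<in> S then \<phi> x else 0"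
  have "isCont ?\<psi> x" for x
  proof (cases "x \<in> S")
    case True
    have "continuous_on S ?\<psi>"
      using assms(2) by (simp add: C_zero_def cong: continuous_on_cong)
    then show ?thesis
      using True assms(1) continuous_on_eq_continuous_at by blast
  next
    case False
    have "\<forall>\<^sub>F y in at x. dist (?\<psi> y) 0 < \<epsilon>" if "\<epsilon> > 0" for \<epsilon>
    proof -
      obtain K where K: "compact K" "K \<subseteq> S" "\<forall>x\<in>S - K. \<bar>\<phi> x\<bar> < \<epsilon>"
        using assms(2) \<open>\<epsilon> > 0\<close> unfolding C_zero_def by blast
      have "\<forall>\<^sub>F y in at x. y \<in> - K"
        using K False by (intro eventually_at_in_open' open_Compl compact_imp_closed) auto
      then show ?thesis
        by eventually_elim (use K \<open>\<epsilon> > 0\<close> in auto)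
    qed
    then show ?thesis
      unfolding isCont_def tendsto_iff using False by simp
  qed
  then show ?thesis
    by (simp add: continuous_at_imp_continuous_on)
qed

text \<open>Square and torus share this reduction: both densities vanish on \<open>S\<close> outside
  Q, so only the values of a test function on Q count, and these agree with a globally continuous
  \<open>\<psi>\<close>. For the square \<open>w\<close> is \<open>u\<close>; for the torus it is
  the periodic extension.\<close>

lemma weak_star_density:
  fixes u w :: "nat \<Rightarrow> real^2 \<Rightarrow> real^2"
  assumes S: "S \<in> sets borel" "square_Q \<subseteq> S"
    and u: "\<And>n. u n \<in> C_infinity_c square_Q"
    and w: "\<And>n. C_infinity (w n)" "\<And>n x. x \<in> S \<Longrightarrow> w n x = u n x"
    and g: "g \<in> borel_measurable borel" "\<And>x. 0 \<le> g x" "\<And>x. indicator S x * g x = 1/4 * indicator square_Q x"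
    and T: "\<And>\<phi>. \<phi> \<in> T \<Longrightarrow> continuous_on S \<phi>"
      "\<And>\<phi>. \<phi> \<in> T \<Longrightarrow> \<exists>\<psi>. continuous_on UNIV \<psi> \<and> (\<forall>x\<in>square_Q. \<psi> x = \<phi> x)"
    and lim: "\<And>\<psi>. continuous_on UNIV \<psi> \<Longrightarrow> (\<lambda>n. \<integral>x. \<psi> x * (norm (u n x))\<^sup>2 \<partial>lborel)
      \<longlonglongrightarrow> (\<integral>x. \<psi> x * (1/4 * indicator square_Q x) \<partial>lborel)"
  shows "weak_star_tendsto S T (\<lambda>n. lebesgue_density S (\<lambda>x. (norm (w n x))\<^sup>2)) (lebesgue_density S g)"
proof -
  have u_0: "u n x = 0" if "x \<notin> square_Q" for n x
  proof -
    obtain K where "K \<subseteq> square_Q" "\<And>x. x \<notin> K \<Longrightarrow> u n x = 0"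
      using C_infinity_cD[OF u[of n]] by blast
    then show ?thesis
      using that by blast
  qed
  have w_meas: "(\<lambda>x. (norm (w n x))\<^sup>2) \<in> borel_measurable borel" for n
    using C_infinity_continuous[OF w(1)]
    by (intro borel_measurable_continuous_onI continuous_intros) auto
  have w_u: "indicator S x * (norm (w n x))\<^sup>2 = (norm (u n x))\<^sup>2" for n x
    using w(2)[of x n] u_0[of x n] S(2) by (auto simp: indicator_def)
  have "integrable lborel (\<lambda>x. (norm (u n x))\<^sup>2)" for n
  proof -
    obtain K where "C_infinity (u n)" "compact K" "\<And>x. x \<notin> K \<Longrightarrow> u n x = 0"
      using C_infinity_cD[OF u[of n]] by blast
    then show ?thesis
      by (intro integrable_continuous_compact_support[of _ K] continuous_intros C_infinity_continuous) auto
  qed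
  then have 1: "lebesgue_density S (\<lambda>x. (norm (w n x))\<^sup>2) \<in> finite_Borel_measures S" for n
    using S(1) w_meas by (intro lebesgue_density_finite_Borel) (auto simp: w_u)
  have "integrable lborel (\<lambda>x. 1/4 * indicator square_Q x :: real)"
    using measure_square_Q open_square_Q by (intro integrable_mult_right) (auto simp: integrable_indicator_iff)
  then have 2: "lebesgue_density S g \<in> finite_Borel_measures S"
    using S(1) g(1,2) by (intro lebesgue_density_finite_Borel) (simp_all only: g(3))
  have 3: "(\<lambda>n. \<integral>x. \<phi> x \<partial>lebesgue_density S (\<lambda>x. (norm (w n x))\<^sup>2)) \<longlonglongrightarrow> (\<integral>x. \<phi> x \<partial>lebesgue_density S g)"
    if \<phi>: "\<phi> \<in> T" for \<phi>
  proof -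
    obtain \<psi> where \<psi>: "continuous_on UNIV \<psi>" "\<And>x. x \<in> square_Q \<Longrightarrow> \<psi> x = \<phi> x"
      using T(2)[OF \<phi>] by blast
    have "(\<integral>x. \<phi> x \<partial>lebesgue_density S (\<lambda>x. (norm (w n x))\<^sup>2)) = (\<integral>x. \<psi> x * (norm (u n x))\<^sup>2 \<partial>lborel)" for n
    proof -
      have "indicator S x * ((norm (w n x))\<^sup>2 * \<phi> x) = \<psi> x * (norm (u n x))\<^sup>2" for x
        using w_u[of x n] u_0[of x n] \<psi>(2)[of x] by (cases "x \<in> square_Q") (auto simp flip: mult.assoc)
      then show ?thesis
        using S(1) w_meas T(1)[OF \<phi>] by (subst lebesgue_density_integral) auto
    qed
    moreover have "(\<integral>x. \<phi> x \<partial>lebesgue_density S g) = (\<integral>x. \<psi> x * (1/4 * indicator square_Q x) \<partial>lborel)"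
    proof -
      have "indicator S x * (g x * \<phi> x) = \<psi> x * (1/4 * indicator square_Q x)" for x
        using g(3)[of x] \<psi>(2)[of x] by (cases "x \<in> square_Q") (auto simp flip: mult.assoc)
      then show ?thesis
        by (simp only: lebesgue_density_integral[OF S(1) g(1,2) T(1)[OF \<phi>]])
    qed
    ultimately show ?thesis
      using lim[OF \<psi>(1)] by (simp only:)
  qed
  show ?thesis
    unfolding weak_star_tendsto_def using 1 2 3 by blast
qed

lemma lattice_of_group:
  assumes "\<Lambda> = lattice_of a b"
  shows "0 \<in> \<Lambda>" "x \<in> \<Lambda> \<Longrightarrow> y \<in> \<Lambda> \<Longrightarrow> x + y \<in> \<Lambda>" "x \<in> \<Lambda> \<Longrightarrow> - x \<in> \<Lambda>"
proof -
  show "0 \<in> \<Lambda>"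
    unfolding assms lattice_of_def by (auto intro!: exI[of _ 0])
  show "x + y \<in> \<Lambda>" if "x \<in> \<Lambda>" "y \<in> \<Lambda>"
  proof -
    obtain m n m' n' :: int where "x = of_int m *\<^sub>R a + of_int n *\<^sub>R b" "y = of_int m' *\<^sub>R a + of_int n' *\<^sub>R b"
      using \<open>x \<in> \<Lambda>\<close> \<open>y \<in> \<Lambda>\<close> unfolding assms lattice_of_def by blast
    then have "x + y = of_int (m + m') *\<^sub>R a + of_int (n + n') *\<^sub>R b"
      by (simp add: scaleR_add_left)
    then show ?thesis
      unfolding assms lattice_of_def by blast
  qed
  show "- x \<in> \<Lambda>" if x: "x \<in> \<Lambda>"
  proof -
    obtain m n :: int where "x = of_int m *\<^sub>R a + of_int n *\<^sub>R b"
      using x unfolding assms lattice_of_def by blast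
    then have "- x = of_int (- m) *\<^sub>R a + of_int (- n) *\<^sub>R b"
      by simp
    then show ?thesis
      unfolding assms lattice_of_def by blast
  qed
qed

lemma incompressible_local:
  assumes "\<And>x. \<exists>S g. open S \<and> x \<in> S \<and> C_infinity g \<and> incompressible g \<and> (\<forall>y\<in>S. f y = g y)"
  shows "incompressible f"
  unfolding incompressible_def
proof
  fix x
  obtain S g where S: "open S" "x \<in> S" "C_infinity g" "incompressible g" "\<forall>y\<in>S. f y = g y"
    using assms by blast
  have "partial_deriv i (\<lambda>y. f y $ i) x = partial_deriv i (\<lambda>y. g y $ i) x" for i
    using S by (intro partial_deriv_cong[of S]) (auto intro!: C_infinity_differentiable C_infinity_nth)
  then show "(\<Sum>i\<in>UNIV. partial_deriv i (\<lambda>y. f y $ i) x) = 0"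
    using S(4) by (simp add: incompressible_def)
qed

text \<open>The domain \<open>D\<close> is merely Borel, so nothing can be read off near its
  boundary. Two kinds of open sets replace it: on a lattice translate of Q the extension is a
  translate of \<open>u\<close>, because Q lies in \<open>D\<close>, and off the lattice translates
  of the support it is 0.\<close>

lemma torus_extension_properties:
  fixes u :: "real^2 \<Rightarrow> real^2"
  assumes \<Lambda>: "is_lattice \<Lambda>" and D: "fundamental_domain \<Lambda> D" "square_Q \<subseteq> D"
    and u: "u \<in> C_infinity_c square_Q" "incompressible u"
  defines "U \<equiv> torus_extension \<Lambda> D u"
  shows "lattice_periodic \<Lambda> U" "C_infinity U" "incompressible U"
    "\<And>x. x \<in> D \<Longrightarrow> U x = u x" "\<And>x. x \<in> D \<Longrightarrow> curl U x = curl u x"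
proof -
  obtain K where K: "C_infinity u" "compact K" "K \<subseteq> square_Q" "\<And>x. x \<notin> K \<Longrightarrow> u x = 0"
    using C_infinity_cD[OF u(1)] by blast
  obtain a b where "\<Lambda> = lattice_of a b"
    using \<Lambda> by (auto simp: is_lattice_def)
  note L = lattice_of_group[OF this]
  have ex1: "\<exists>!y. y \<in> D \<and> x - y \<in> \<Lambda>" for x
    using D(1) by (auto simp: fundamental_domain_def)
  have U: "U x = u y" if "y \<in> D" "x - y \<in> \<Lambda>" for x y
    unfolding U_def torus_extension_def using that ex1[of x] by (metis (mono_tags, lifting) the_equality)
  show U_D: "U x = u x" if "x \<in> D" for x
    using that by (intro U) (auto simp: L)
  show "lattice_periodic \<Lambda> U"
    unfolding lattice_periodic_def
  proof (intro allI ballI)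
    fix x l assume "l \<in> \<Lambda>"
    obtain y where "y \<in> D" "x - y \<in> \<Lambda>"
      using ex1 by blast
    moreover have "x + l - y \<in> \<Lambda>"
      using L(2)[OF \<open>x - y \<in> \<Lambda>\<close> \<open>l \<in> \<Lambda>\<close>] by (simp add: algebra_simps)
    ultimately show "U (x + l) = U x"
      using U by metis
  qed
  have Q0: "0 \<in> square_Q"
    by (simp add: square_Q_def)
  \<comment> \<open>Discreteness comes from \<open>Q \<subseteq> D\<close> alone: a short lattice vector would represent the class of \<open>0\<close> a second time.\<close>
  have \<Lambda>_discrete: "l = 0" if "l \<in> \<Lambda>" "norm l < 1/2" for l
  proof -
    have "l \<in> square_Q"
      using that(2) cball_subset_square_Q by auto
    then have "l \<in> D \<and> l - l \<in> \<Lambda>" "0 \<in> D \<and> l - 0 \<in> \<Lambda>"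
      using that(1) D(2) Q0 L(1) by auto
    then show ?thesis
      using ex1[of l] by blast
  qed
  have "closed \<Lambda>"
  proof (rule discrete_imp_closed[of "1/2"])
    show "\<forall>x\<in>\<Lambda>. \<forall>y\<in>\<Lambda>. dist y x < 1/2 \<longrightarrow> y = x"
    proof (intro ballI impI)
      fix x y assume "x \<in> \<Lambda>" "y \<in> \<Lambda>" "dist y x < 1/2"
      then show "y = x"
        using \<Lambda>_discrete[of "y - x"] L(2)[of y "- x"] L(3)[of x] by (simp add: dist_norm)
    qed
  qed simp
  \<comment> \<open>A compact set plus a closed set is closed, so the complement of \<open>Z\<close>
    is an open set on which the extension vanishes.\<close>
  define Z where "Z = (\<Union>x\<in>K. \<Union>l\<in>\<Lambda>. {x + l})"
  have "closed Z"
    unfolding Z_def using K(2) \<open>closed \<Lambda>\<close> by (rule compact_closed_sums)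
  have U_0: "U x = 0" if "x \<in> - Z" for x
  proof -
    obtain y where y: "y \<in> D" "x - y \<in> \<Lambda>"
      using ex1 by blast
    have "y \<notin> K"
    proof
      assume "y \<in> K"
      then have "y + (x - y) \<in> Z"
        unfolding Z_def using y(2) by blast
      then show False
        using that by simp
    qed
    then show ?thesis
      using U[OF y] K(4) by simp
  qed
  have inc_0: "incompressible (\<lambda>x. 0 :: real^2)"
    unfolding incompressible_def by (simp add: partial_deriv_eq[OF has_derivative_const])
  have inc_shift: "incompressible (\<lambda>x. u (x + c))" for c
    using incompressible_superposition[OF K(1) u(2), where I = "{()}" and a = "\<lambda>_. 1" and r = "\<lambda>_. 1" and c = "\<lambda>_. c"] by simp
  have loc: "\<exists>S g. open S \<and> x \<in> S \<and> C_infinity g \<and> incompressible g \<and> (\<forall>y\<in>S. U y = g y)" for x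
  proof (cases "x \<in> Z")
    case True
    then obtain y l where yl: "y \<in> K" "l \<in> \<Lambda>" "x = y + l"
      by (auto simp: Z_def)
    have "open ((\<lambda>z. z + - l) -` square_Q)"
      by (intro open_vimage open_square_Q continuous_intros)
    moreover have "U z = u (z + - l)" if "z \<in> (\<lambda>z. z + - l) -` square_Q" for z
      using that D(2) yl(2) by (intro U) auto
    moreover have "C_infinity (\<lambda>z. u (z + - l))"
      using C_infinity_affine[OF K(1), of 1 "- l"] by simp
    ultimately show ?thesis
      using yl K(3) inc_shift[of "- l"]
      by (intro exI[of _ "(\<lambda>z. z + - l) -` square_Q"] exI[of _ "\<lambda>z. u (z + - l)"]) auto
  next
    case False
    then show ?thesis
      using \<open>closed Z\<close> U_0 inc_0
      by (intro exI[of _ "- Z"] exI[of _ "\<lambda>_. 0"]) (auto simp: C_infinity_const)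
  qed
  show "C_infinity U"
    using loc by (intro C_infinity_local) blast
  show "incompressible U"
    using loc by (intro incompressible_local) blast
  show "curl U x = curl u x" if "x \<in> D" for x
  proof (cases "x \<in> square_Q")
    case True
    have "partial_deriv i (\<lambda>y. U y $ j) x = partial_deriv i (\<lambda>y. u y $ j) x" for i j
      using True open_square_Q D(2) U_D C_infinity_differentiable[OF C_infinity_nth[OF K(1)]]
      by (intro partial_deriv_cong[of square_Q]) auto
    then show ?thesis
      by (simp add: curl_def)
  next
    case False
    \<comment> \<open>A point of \<open>D\<close> in \<open>Z\<close> has a second representative in
      \<open>K\<close>; uniqueness makes the two equal and puts the point in Q.\<close>
    have "x \<notin> Z"
    proof
      assume "x \<in> Z"
      then obtain y l where yl: "y \<in> K" "l \<in> \<Lambda>" "x = y + l"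
        by (auto simp: Z_def)
      then have "x \<in> D \<and> x - x \<in> \<Lambda>" "y \<in> D \<and> x - y \<in> \<Lambda>"
        using that K(3) D(2) L(1) by auto
      then have "x = y"
        using ex1[of x] by blast
      then show False
        using yl K(3) False by auto
    qed
    then have "partial_deriv i (\<lambda>y. U y $ j) x = partial_deriv i (\<lambda>y. 0) x" for i j
      using \<open>closed Z\<close> U_0 by (intro partial_deriv_cong[of "- Z"]) auto
    then have "curl U x = 0"
      by (simp add: curl_def partial_deriv_eq[OF has_derivative_const])
    moreover have "curl u x = 0"
      using False K by (intro curl_eq_0[of K]) auto
    ultimately show ?thesis
      by simp
  qed
qed

text \<open>The constants come from 1 <= \<open>\<theta>\<close> <= (1 + 1/(n+1))^2 <= 1 + 3/(n+1),
  which also gives \<open>\<theta>\<close> + 1 <= 5.\<close>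

lemma spread_out_vortices:
  "\<exists>u :: real^2 \<Rightarrow> real^2. u \<in> C_infinity_c square_Q \<and> incompressible u
    \<and> (\<integral>x. norm (u x) \<partial>lborel) \<le> 1 / real (Suc n) \<and> (\<integral>x. \<bar>curl u x\<bar> \<partial>lborel) = 1
    \<and> (\<forall>\<psi> B \<epsilon>. continuous_on UNIV \<psi> \<longrightarrow> (\<forall>x\<in>square_Q. \<bar>\<psi> x\<bar> \<le> B) \<longrightarrow>
      (\<forall>x\<in>square_Q. \<forall>y\<in>square_Q. dist x y \<le> 2 / real (Suc n) \<longrightarrow> \<bar>\<psi> x - \<psi> y\<bar> \<le> \<epsilon>) \<longrightarrow>
      \<bar>(\<integral>x. \<psi> x * (norm (u x))\<^sup>2 \<partial>lborel) - (\<integral>x. \<psi> x * (1/4 * indicator square_Q x) \<partial>lborel)\<bar>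
        \<le> B * (3 / real (Suc n)) + \<epsilon> * 5)"
proof -
  obtain C where C: "C > 0" and ex: "\<And>E. \<exists>V. V \<in> C_infinity_c square_Q \<and> incompressible V
    \<and> (\<integral>x. norm (V x) \<partial>lborel) \<le> C \<and> 0 < (\<integral>x. \<bar>curl V x\<bar> \<partial>lborel)
    \<and> (\<integral>x. \<bar>curl V x\<bar> \<partial>lborel) \<le> C \<and> E \<le> (\<integral>x. (norm (V x))\<^sup>2 \<partial>lborel)"
    using concentrated_vortex by blast
  obtain V where V: "V \<in> C_infinity_c square_Q" "incompressible V"
    and L: "(\<integral>x. norm (V x) \<partial>lborel) \<le> C"
    and W: "0 < (\<integral>x. \<bar>curl V x\<bar> \<partial>lborel)" "(\<integral>x. \<bar>curl V x\<bar> \<partial>lborel) \<le> C"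
    \<comment> \<open>One \<open>C\<close> is lost when \<open>N\<close> is rounded: N W > sqrt e -
      W >= (n+2) C - C. The remaining (n+1) C gives the L1 bound 1/(n+1).\<close>
    and E: "((real n + 2) * C)\<^sup>2 \<le> (\<integral>x. (norm (V x))\<^sup>2 \<partial>lborel)"
    using ex by blast
  define W where "W = (\<integral>x. \<bar>curl V x\<bar> \<partial>lborel)"
  define e where "e = (\<integral>x. (norm (V x))\<^sup>2 \<partial>lborel)"
  \<comment> \<open>Rounding down gives N W <= sqrt e < (N+1) W, hence \<open>\<theta>\<close>
    between 1 and (1 + 1/N)^2. Only an upper bound on \<open>W\<close> is available in advance, so
    \<open>N\<close> is chosen after \<open>V\<close>.\<close>
  define N where "N = nat \<lfloor>sqrt e / W\<rfloor>"
  have W0: "W > 0" "W \<le> C"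
    using W by (auto simp: W_def)
  have e: "(real n + 2) * C \<le> sqrt e"
    using E C by (simp add: e_def real_le_rsqrt)
  have e0: "e \<ge> 0"
    by (simp add: e_def)
  have "(real n + 2) * W \<le> sqrt e"
    using e W0 by (meson add_nonneg_nonneg mult_left_mono of_nat_0_le_iff order_trans zero_le_numeral)
  then have r: "real n + 2 \<le> sqrt e / W"
    using W0 by (simp add: field_simps)
  then have "real N = real_of_int \<lfloor>sqrt e / W\<rfloor>"
    by (simp add: N_def)
  then have N: "real N \<le> sqrt e / W" "sqrt e / W < real N + 1"
    by linarith+
  then have N_n: "N \<ge> Suc n"
    using r by linarith
  have NW: "real N * W \<le> sqrt e" "sqrt e < (real N + 1) * W"
    using N W0 by (simp_all add: field_simps)
  define \<theta> where "\<theta> = e / (real N * W)\<^sup>2"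
  have N0: "real N * W > 0"
    using N_n W0 by simp
  have \<theta>: "\<theta> = (sqrt e / (real N * W))\<^sup>2"
    using e0 by (simp add: \<theta>_def power_divide)
  have \<theta>_1: "1 \<le> \<theta>"
    using N0 NW(1) unfolding \<theta> by (intro one_le_power) simp
  have "sqrt e / (real N * W) \<le> (real N + 1) * W / (real N * W)"
    using NW(2) N0 by (intro divide_right_mono) auto
  also have "\<dots> = 1 + 1 / real N"
    using N_n W0 by (simp add: field_simps)
  also have "\<dots> \<le> 1 + 1 / real (Suc n)"
    using N_n by (intro add_left_mono divide_left_mono) auto
  finally have "\<theta> \<le> (1 + 1 / real (Suc n))\<^sup>2"
    unfolding \<theta> using e0 N0 by (intro power_mono) auto
  also have "\<dots> = 1 + 1 / real (Suc n) * (2 + 1 / real (Suc n))"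
    by (simp add: power2_eq_square algebra_simps)
  also have "\<dots> \<le> 1 + 1 / real (Suc n) * (2 + 1)"
    by (intro add_left_mono mult_left_mono) (auto simp: field_simps)
  finally have \<theta>_2: "\<theta> \<le> 1 + 3 / real (Suc n)"
    by simp
  moreover have "3 / real (Suc n) \<le> 3"
    by (simp add: field_simps)
  ultimately have \<theta>_3: "\<theta> + 1 \<le> 5"
    by simp
  have N1: "1 \<le> N"
    using N_n by simp
  show ?thesis
  proof (rule vortex_array[OF V N1 W(1), folded W_def e_def, folded \<theta>_def])
    fix u
    assume u: "u \<in> C_infinity_c square_Q" "incompressible u"
      "(\<integral>x. norm (u x) \<partial>lborel) = (\<integral>x. norm (V x) \<partial>lborel) / (real N * W)" "(\<integral>x. \<bar>curl u x\<bar> \<partial>lborel) = 1"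
      "\<And>\<psi> B \<epsilon>. continuous_on UNIV \<psi> \<Longrightarrow> (\<And>x. x \<in> square_Q \<Longrightarrow> \<bar>\<psi> x\<bar> \<le> B) \<Longrightarrow>
        (\<And>x y. x \<in> square_Q \<Longrightarrow> y \<in> square_Q \<Longrightarrow> dist x y \<le> 2 / real N \<Longrightarrow> \<bar>\<psi> x - \<psi> y\<bar> \<le> \<epsilon>) \<Longrightarrow>
        \<bar>(\<integral>x. \<psi> x * (norm (u x))\<^sup>2 \<partial>lborel) - (\<integral>x. \<psi> x * (1/4 * indicator square_Q x) \<partial>lborel)\<bar>
          \<le> B * \<bar>\<theta> - 1\<bar> + \<epsilon> * (\<theta> + 1)"
    have "real (Suc n) * C \<le> real N * W"
    proof -
      have "(real n + 2) * C < real N * W + W"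
        using e NW(2) by (simp add: distrib_right)
      then show ?thesis
        using W0 by (simp add: algebra_simps)
    qed
    then have "(\<integral>x. norm (V x) \<partial>lborel) / (real N * W) \<le> C / (real (Suc n) * C)"
      using L C by (intro frac_le) auto
    then have "(\<integral>x. norm (u x) \<partial>lborel) \<le> 1 / real (Suc n)"
      using C u(3) by simp
    moreover have "\<bar>(\<integral>x. \<psi> x * (norm (u x))\<^sup>2 \<partial>lborel) - (\<integral>x. \<psi> x * (1/4 * indicator square_Q x) \<partial>lborel)\<bar>
        \<le> B * (3 / real (Suc n)) + \<epsilon> * 5"
      if \<psi>: "continuous_on UNIV \<psi>" and B: "\<forall>x\<in>square_Q. \<bar>\<psi> x\<bar> \<le> B"
        and \<epsilon>: "\<forall>x\<in>square_Q. \<forall>y\<in>square_Q. dist x y \<le> 2 / real (Suc n) \<longrightarrow> \<bar>\<psi> x - \<psi> y\<bar> \<le> \<epsilon>"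
      for \<psi> B \<epsilon>
    proof -
      have "2 / real N \<le> 2 / real (Suc n)"
        using N_n by (intro divide_left_mono) auto
      then have "\<bar>\<psi> x - \<psi> y\<bar> \<le> \<epsilon>" if "x \<in> square_Q" "y \<in> square_Q" "dist x y \<le> 2 / real N" for x y
        using that \<epsilon> order_trans by blast
      then have "\<bar>(\<integral>x. \<psi> x * (norm (u x))\<^sup>2 \<partial>lborel) - (\<integral>x. \<psi> x * (1/4 * indicator square_Q x) \<partial>lborel)\<bar>
          \<le> B * \<bar>\<theta> - 1\<bar> + \<epsilon> * (\<theta> + 1)"
        using \<psi> B by (intro u(5)) auto
      also have "\<dots> \<le> B * (3 / real (Suc n)) + \<epsilon> * 5"
      proof (intro add_mono mult_left_mono)
        \<comment> \<open>Evaluating the hypotheses at the point 0 of Q shows that both bounds are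
          nonnegative.\<close>
        have Q0: "0 \<in> square_Q"
          by (simp add: square_Q_def)
        then show "0 \<le> B" "0 \<le> \<epsilon>"
          using B \<epsilon> by fastforce+
      qed (use \<theta>_1 \<theta>_2 \<theta>_3 in auto)
      finally show ?thesis .
    qed
    ultimately show ?thesis
      using u(1,2,4) by blast
  qed
qed

text \<open>On the torus the limit is carried by Q, because the fields vanish on the rest of
  \<open>D\<close>. If \<open>D\<close> has area 4, the indicator is 1 almost everywhere on
  \<open>D\<close> and the limit is again 1/4 of Lebesgue measure.\<close>

theorem proposition7p2:
  "\<exists>u :: nat \<Rightarrow> real^2 \<Rightarrow> real^2.
     (\<forall>n. u n \<in> C_infinity_c square_Q \<and> incompressible (u n)) \<and>
     (\<lambda>n. L1_norm square_Q (u n)) \<longlonglongrightarrow> 0 \<and>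
     (\<forall>n. L1_norm square_Q (curl (u n)) = 1) \<and>
     weak_star_tendsto square_Q (C_zero square_Q)
       (\<lambda>n. lebesgue_density square_Q (\<lambda>x. (norm (u n x))\<^sup>2))
       (lebesgue_density square_Q (\<lambda>x. 1/4)) \<and>
     (\<forall>\<Lambda> D. is_lattice \<Lambda> \<and> fundamental_domain \<Lambda> D \<and> square_Q \<subseteq> D \<longrightarrow>
        (let U = (\<lambda>n. torus_extension \<Lambda> D (u n)) in
          (\<forall>n. lattice_periodic \<Lambda> (U n) \<and> C_infinity (U n) \<and> incompressible (U n)) \<and>
          (\<lambda>n. L1_norm D (U n)) \<longlonglongrightarrow> 0 \<and>
          (\<forall>n. L1_norm D (curl (U n)) = 1) \<and>
          weak_star_tendsto D (C_torus \<Lambda>)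
            (\<lambda>n. lebesgue_density D (\<lambda>x. (norm (U n x))\<^sup>2))
            (lebesgue_density D (\<lambda>x. 1/4 * indicator square_Q x))))"
proof -
  from choice[OF allI[OF spread_out_vortices]] obtain u :: "nat \<Rightarrow> real^2 \<Rightarrow> real^2" where
    *: "\<forall>n. u n \<in> C_infinity_c square_Q \<and> incompressible (u n)
    \<and> (\<integral>x. norm (u n x) \<partial>lborel) \<le> 1 / real (Suc n) \<and> (\<integral>x. \<bar>curl (u n) x\<bar> \<partial>lborel) = 1
    \<and> (\<forall>\<psi> B \<epsilon>. continuous_on UNIV \<psi> \<longrightarrow> (\<forall>x\<in>square_Q. \<bar>\<psi> x\<bar> \<le> B) \<longrightarrow>
      (\<forall>x\<in>square_Q. \<forall>y\<in>square_Q. dist x y \<le> 2 / real (Suc n) \<longrightarrow> \<bar>\<psi> x - \<psi> y\<bar> \<le> \<epsilon>) \<longrightarrow>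
      \<bar>(\<integral>x. \<psi> x * (norm (u n x))\<^sup>2 \<partial>lborel) - (\<integral>x. \<psi> x * (1/4 * indicator square_Q x) \<partial>lborel)\<bar>
        \<le> B * (3 / real (Suc n)) + \<epsilon> * 5)" ..
  have u: "\<And>n. u n \<in> C_infinity_c square_Q" "\<And>n. incompressible (u n)"
    and L: "\<And>n. (\<integral>x. norm (u n x) \<partial>lborel) \<le> 1 / real (Suc n)"
    and W: "\<And>n. (\<integral>x. \<bar>curl (u n) x\<bar> \<partial>lborel) = 1"
    and est: "\<And>n \<psi> B \<epsilon>. continuous_on UNIV \<psi> \<Longrightarrow> (\<forall>x\<in>square_Q. \<bar>\<psi> x\<bar> \<le> B) \<Longrightarrow>
      (\<forall>x\<in>square_Q. \<forall>y\<in>square_Q. dist x y \<le> 2 / real (Suc n) \<longrightarrow> \<bar>\<psi> x - \<psi> y\<bar> \<le> \<epsilon>) \<Longrightarrow>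
      \<bar>(\<integral>x. \<psi> x * (norm (u n x))\<^sup>2 \<partial>lborel) - (\<integral>x. \<psi> x * (1/4 * indicator square_Q x) \<partial>lborel)\<bar>
        \<le> B * (3 / real (Suc n)) + \<epsilon> * 5"
    using * by blast+
  have u_0: "u n x = 0" and curl_0: "curl (u n) x = 0" if "x \<notin> square_Q" for n x
  proof -
    obtain K where "compact K" "K \<subseteq> square_Q" "\<And>x. x \<notin> K \<Longrightarrow> u n x = 0"
      using C_infinity_cD[OF u(1)[of n]] by blast
    then show "u n x = 0" "curl (u n) x = 0"
      using that curl_eq_0[of K "u n" x] by auto
  qed
  have L_lim: "(\<lambda>n. \<integral>x. norm (u n x) \<partial>lborel) \<longlonglongrightarrow> 0"
    using L by (intro tendsto_sandwich[OF _ _ tendsto_const LIMSEQ_inverse_real_of_nat]) (auto simp: inverse_eq_divide)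
  have lim: "(\<lambda>n. \<integral>x. \<psi> x * (norm (u n x))\<^sup>2 \<partial>lborel) \<longlonglongrightarrow> (\<integral>x. \<psi> x * (1/4 * indicator square_Q x) \<partial>lborel)"
    if \<psi>: "continuous_on UNIV \<psi>" for \<psi>
  proof -
    let ?C = "cbox (\<chi> i. -1) (\<chi> i. 1) :: (real^2) set"
    have QC: "square_Q \<subseteq> ?C"
      unfolding square_Q_eq_box by (rule box_subset_cbox)
    have \<psi>C: "continuous_on ?C \<psi>"
      using \<psi> continuous_on_subset by blast
    then have "bounded (\<psi> ` ?C)"
      by (intro compact_imp_bounded compact_continuous_image) auto
    then obtain B where B: "\<And>x. x \<in> square_Q \<Longrightarrow> \<bar>\<psi> x\<bar> \<le> B"
      using QC by (auto simp: bounded_iff)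
    have "uniformly_continuous_on ?C \<psi>"
      using \<psi>C by (intro compact_uniformly_continuous) auto
    show ?thesis
    proof (rule LIMSEQ_I)
      fix r :: real assume r: "r > 0"
      \<comment> \<open>The bound r/10 is multiplied by 5 in the estimate and uses up r/2; the term
        with \<open>B\<close> tends to 0. Uniform continuity is taken on the closed square, which is
        compact and contains Q.\<close>
      then obtain d where d: "d > 0" "\<And>x y. x \<in> ?C \<Longrightarrow> y \<in> ?C \<Longrightarrow> dist y x < d \<Longrightarrow> \<bar>\<psi> y - \<psi> x\<bar> < r / 10"
        using \<open>uniformly_continuous_on ?C \<psi>\<close> unfolding uniformly_continuous_on_def dist_real_def
        by (metis divide_pos_pos zero_less_numeral)
      have "(\<lambda>n. B * (3 * inverse (real (Suc n))) + r / 10 * 5) \<longlonglongrightarrow> B * (3 * 0) + r / 10 * 5"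
        by (intro tendsto_intros LIMSEQ_inverse_real_of_nat)
      then have "\<forall>\<^sub>F n in sequentially. B * (3 * inverse (real (Suc n))) + r / 10 * 5 < r"
        by (rule order_tendstoD) (use r in simp)
      moreover have "\<forall>\<^sub>F n in sequentially. 2 * inverse (real (Suc n)) < d"
        using tendsto_mult_right_zero[OF LIMSEQ_inverse_real_of_nat, of 2] d(1) by (rule order_tendstoD)
      ultimately have "\<forall>\<^sub>F n in sequentially. norm ((\<integral>x. \<psi> x * (norm (u n x))\<^sup>2 \<partial>lborel)
          - (\<integral>x. \<psi> x * (1/4 * indicator square_Q x) \<partial>lborel)) < r"
      proof eventually_elim
        case (elim n)
        have "\<bar>\<psi> x - \<psi> y\<bar> \<le> r / 10" if "x \<in> square_Q" "y \<in> square_Q" "dist x y \<le> 2 / real (Suc n)" for x y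
        proof -
          have "dist x y < d"
            using that(3) elim(2) by (simp add: inverse_eq_divide)
          then show ?thesis
            using d(2)[of y x] that(1,2) QC by (meson less_imp_le subsetD)
        qed
        then have "\<bar>(\<integral>x. \<psi> x * (norm (u n x))\<^sup>2 \<partial>lborel) - (\<integral>x. \<psi> x * (1/4 * indicator square_Q x) \<partial>lborel)\<bar>
            \<le> B * (3 / real (Suc n)) + r / 10 * 5"
          using B by (intro est[OF \<psi>]) auto
        then show ?case
          using elim(1) by (simp add: inverse_eq_divide)
      qed
      then show "\<exists>no. \<forall>n\<ge>no. norm ((\<integral>x. \<psi> x * (norm (u n x))\<^sup>2 \<partial>lborel)
          - (\<integral>x. \<psi> x * (1/4 * indicator square_Q x) \<partial>lborel)) < r"
        by (simp add: eventually_sequentially)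
    qed
  qed
  have Q_borel: "square_Q \<in> sets borel"
    using open_square_Q by simp
  show ?thesis
  proof (intro exI[of _ u] conjI allI impI)
    fix n
    show "u n \<in> C_infinity_c square_Q" "incompressible (u n)"
      by (fact u)+
    show "L1_norm square_Q (curl (u n)) = 1"
      using L1_norm_eq_integral[of square_Q "curl (u n)" "curl (u n)"] W curl_0 by simp
  next
    show "(\<lambda>n. L1_norm square_Q (u n)) \<longlonglongrightarrow> 0"
      using L_lim L1_norm_eq_integral[of square_Q "u _" "u _"] u_0 by simp
    have "\<exists>\<psi>. continuous_on UNIV \<psi> \<and> (\<forall>x\<in>square_Q. \<psi> x = \<phi> x)" if "\<phi> \<in> C_zero square_Q" for \<phi>
      using C_zero_extension[OF open_square_Q that]
      by (intro exI[of _ "\<lambda>x. if x \<in> square_Q then \<phi> x else 0"]) auto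
    then show "weak_star_tendsto square_Q (C_zero square_Q)
       (\<lambda>n. lebesgue_density square_Q (\<lambda>x. (norm (u n x))\<^sup>2)) (lebesgue_density square_Q (\<lambda>x. 1/4))"
      using u lim Q_borel C_infinity_cD(1)[OF u(1)]
      by (intro weak_star_density[where u = u]) (auto simp: C_zero_def)
  next
    fix \<Lambda> D assume "is_lattice \<Lambda> \<and> fundamental_domain \<Lambda> D \<and> square_Q \<subseteq> D"
    then have D: "is_lattice \<Lambda>" "fundamental_domain \<Lambda> D" "square_Q \<subseteq> D"
      by auto
    note U = torus_extension_properties[OF D u]
    have "L1_norm D (torus_extension \<Lambda> D (u n)) = (\<integral>x. norm (u n x) \<partial>lborel)" for n
      using D(3) by (intro L1_norm_eq_integral) (auto intro: U(4) u_0)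
    moreover have "L1_norm D (curl (torus_extension \<Lambda> D (u n))) = 1" for n
    proof -
      have "L1_norm D (curl (torus_extension \<Lambda> D (u n))) = (\<integral>x. norm (curl (u n) x) \<partial>lborel)"
        using D(3) by (intro L1_norm_eq_integral) (auto intro: U(5) curl_0)
      then show ?thesis
        using W by simp
    qed
    moreover have "weak_star_tendsto D (C_torus \<Lambda>)
        (\<lambda>n. lebesgue_density D (\<lambda>x. (norm (torus_extension \<Lambda> D (u n) x))\<^sup>2))
        (lebesgue_density D (\<lambda>x. 1/4 * indicator square_Q x))"
    proof (rule weak_star_density[where u = u])
      show "D \<in> sets borel"
        using D(2) by (simp add: fundamental_domain_def)
      show "(\<lambda>x. 1/4 * indicator square_Q x :: real) \<in> borel_measurable borel"
        using Q_borel by simp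
      show "indicator D x * (1/4 * indicator square_Q x) = (1/4 * indicator square_Q x :: real)" for x
        using D(3) by (auto simp: indicator_def)
      fix \<phi> assume "\<phi> \<in> C_torus \<Lambda>"
      then have "continuous_on UNIV \<phi>"
        by (simp add: C_torus_def)
      then show "continuous_on D \<phi>" "\<exists>\<psi>. continuous_on UNIV \<psi> \<and> (\<forall>x\<in>square_Q. \<psi> x = \<phi> x)"
        by (auto intro: continuous_on_subset)
    qed (use D u U lim in auto)
    ultimately show "let U = (\<lambda>n. torus_extension \<Lambda> D (u n)) in
          (\<forall>n. lattice_periodic \<Lambda> (U n) \<and> C_infinity (U n) \<and> incompressible (U n)) \<and>
          (\<lambda>n. L1_norm D (U n)) \<longlonglongrightarrow> 0 \<and>
          (\<forall>n. L1_norm D (curl (U n)) = 1) \<and>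
          weak_star_tendsto D (C_torus \<Lambda>)
            (\<lambda>n. lebesgue_density D (\<lambda>x. (norm (U n x))\<^sup>2))
            (lebesgue_density D (\<lambda>x. 1/4 * indicator square_Q x))"
      using U(1-3) L_lim by (simp add: Let_def)
  qed
qed

end
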